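(* Let $X$ be a locally compact group with left Haar measure $\lambda$. Let $\{k_{\beta}\}$ be a family of nonnegative lower semicontinuous real valued functions defined on $X$, set $k^*v := \sup_{\beta}|v*k_{\beta}|$, where $v$ is either a function or a measure, and let $c>0$ be a fixed constant. Then the following are equivalent: (i) For every function $f\in L_1(\lambda)$ and every $\alpha > 0$, \[ \alpha\, \lambda \{k^*f > \alpha\} \le c\, \|f\|_1. \] (ii) For every finite real valued Radon measure $\mu$ on $X$ and every $\alpha > 0$, \[ \alpha\, \lambda \{k^*\mu > \alpha\} \le c\, |\mu|(X). \] The same result (the equivalence of (i) and (ii)) holds if, instead of a family of lower semicontinuous functions, $\{k_{n}\}$ is a sequence of nonnegative real valued Borel functions on $X$, with $k^*v := \sup_n |v*k_n|$.
   Context: $X$ is a locally compact group and $\lambda$ is its left Haar measure; $dx$ means $d\lambda(x)$, and $\|\cdot\|_1$ is the $L_1$ norm with respect to $\lambda$. A finite real valued Borel measure $\mu$ on $X$ is called Radon if its total variation $|\mu|$ is inner regular with respect to the compact sets. Convolutions are defined by \[ h*f(x) = \int f(y^{-1}x)\, h(y)\, dy, \qquad \mu*f(x) = \int f(y^{-1}x)\, d\mu(y), \] for functions $h, f$ and a measure $\mu$ on $X$. The notation $\{g>\alpha\}$ means $\{x\in X: g(x)>\alpha\}$. *)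

theory Defs
  imports "HOL-Analysis.Analysis"
begin

text \<open>
  Groups are written additively: the class \<open>topological_group_add\<close> does not assume
  commutativity, so \<open>y\<^sup>-\<^sup>1 x\<close> becomes \<open>- y + x\<close>.
\<close>

definition left_haar_measure :: "'a::topological_group_add measure \<Rightarrow> bool" where
  "left_haar_measure M \<longleftrightarrow>
     sets M = sets borel \<and>
     emeasure M UNIV \<noteq> 0 \<and>
     (\<forall>K. compact K \<longrightarrow> emeasure M K < \<infinity>) \<and>
     (\<forall>x. \<forall>A\<in>sets borel. emeasure M ((+) x ` A) = emeasure M A) \<and>
     (\<forall>A\<in>sets borel. emeasure M A = (SUP K\<in>{K. compact K \<and> K \<subseteq> A}. emeasure M K))"
  \<comment> \<open>Regularity is inner regularity by compact sets on all Borel sets. For groups that are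
     not \<open>\<sigma>\<close>-compact this differs from the convention ``outer regular, and inner regular on
     open sets'' by the value (\<open>0\<close> instead of \<open>\<infinity>\<close>) of some locally null Borel sets.\<close>

definition lower_semicontinuous :: "('a::topological_space \<Rightarrow> real) \<Rightarrow> bool" where
  "lower_semicontinuous f \<longleftrightarrow> (\<forall>a. open {x. f x > a})"

text \<open>Finite real valued Borel measures are set functions; only their values on Borel sets matter.\<close>

definition finite_real_borel_measure :: "('a::topological_space set \<Rightarrow> real) \<Rightarrow> bool" where
  "finite_real_borel_measure \<mu> \<longleftrightarrow>
     \<mu> {} = 0 \<and>
     (\<forall>A::nat \<Rightarrow> 'a set. range A \<subseteq> sets borel \<longrightarrow> disjoint_family A \<longrightarrow>
        (\<lambda>i. \<mu> (A i)) sums \<mu> (\<Union>i. A i))"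

definition total_variation :: "('a::topological_space set \<Rightarrow> real) \<Rightarrow> 'a set \<Rightarrow> ennreal" where
  "total_variation \<mu> A =
     (SUP P\<in>{P. finite P \<and> P \<subseteq> sets borel \<and> disjoint P \<and> \<Union>P = A}. \<Sum>B\<in>P. ennreal \<bar>\<mu> B\<bar>)"

definition radon_real_measure :: "('a::topological_space set \<Rightarrow> real) \<Rightarrow> bool" where
  "radon_real_measure \<mu> \<longleftrightarrow>
     finite_real_borel_measure \<mu> \<and>
     (\<forall>A\<in>sets borel.
        total_variation \<mu> A = (SUP K\<in>{K. compact K \<and> K \<subseteq> A}. total_variation \<mu> K))"

text \<open>The Jordan decomposition \<open>\<mu> = \<mu>\<^sup>+ - \<mu>\<^sup>-\<close>, with \<open>\<mu>\<^sup>+(A) = sup {\<mu>(B) | B \<subseteq> A}\<close>.\<close>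

definition pos_part_measure :: "('a::topological_space set \<Rightarrow> real) \<Rightarrow> 'a measure" where
  "pos_part_measure \<mu> =
     measure_of UNIV (sets borel) (\<lambda>A. SUP B\<in>{B\<in>sets borel. B \<subseteq> A}. ennreal (\<mu> B))"

definition neg_part_measure :: "('a::topological_space set \<Rightarrow> real) \<Rightarrow> 'a measure" where
  "neg_part_measure \<mu> = pos_part_measure (\<lambda>A. - \<mu> A)"

lemma sets_pos_part_measure [simp, measurable_cong]:
  "sets (pos_part_measure (\<mu> :: 'a::topological_space set \<Rightarrow> real)) = sets borel"
proof -
  have "sigma_sets UNIV (sets (borel :: 'a measure)) = sets borel"
    using sets.sigma_sets_eq[of "borel :: 'a measure"] by simp
  then show ?thesis
    unfolding pos_part_measure_def by (simp add: sets_measure_of)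
qed

text \<open>The set function defining \<^const>\<open>pos_part_measure\<close> is countably additive.\<close>

lemma emeasure_pos_part_measure:
  fixes \<mu> :: "'a::topological_space set \<Rightarrow> real"
  assumes \<mu>: "finite_real_borel_measure \<mu>" and A: "A \<in> sets borel"
  shows "emeasure (pos_part_measure \<mu>) A = (SUP B\<in>{B\<in>sets borel. B \<subseteq> A}. ennreal (\<mu> B))"
proof -
  define p where "p A = (SUP B\<in>{B\<in>sets borel. B \<subseteq> A}. ennreal (\<mu> B))" for A
  have empty: "\<mu> {} = 0"
    using \<mu> by (simp add: finite_real_borel_measure_def)
  have sums: "(\<lambda>i. \<mu> (F i)) sums \<mu> (\<Union>i. F i)"
      if "range F \<subseteq> sets borel" "disjoint_family F" for F :: "nat \<Rightarrow> 'a set"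
    using \<mu> that by (auto simp: finite_real_borel_measure_def)
  have two: "\<mu> (B \<union> C) = \<mu> B + \<mu> C"
    if BC: "B \<in> sets borel" "C \<in> sets borel" "B \<inter> C = {}" for B C
  proof -
    have "(\<lambda>i. \<mu> (binaryset B C i)) sums \<mu> (\<Union>i. binaryset B C i)"
      using BC by (intro sums) (auto simp: binaryset_def disjoint_family_on_def)
    moreover have "(\<lambda>i. \<mu> (binaryset B C i)) sums (\<mu> B + \<mu> C)"
      using empty by (intro binaryset_sums) auto
    ultimately show ?thesis
      by (metis UN_binaryset_eq sums_unique2)
  qed
  have p_ge: "ennreal (\<mu> B) \<le> p A" if "B \<in> sets borel" "B \<subseteq> A" for A B
    unfolding p_def using that by (intro SUP_upper) auto
  have add: "p B + p C \<le> p (B \<union> C)" if "B \<inter> C = {}" for B C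
  proof -
    have nonempty: "{B'\<in>sets borel. B' \<subseteq> D} \<noteq> {}" for D :: "'a set"
      by (auto intro!: exI[of _ "{}"])
    have "ennreal (\<mu> B') + ennreal (\<mu> C') \<le> p (B \<union> C)"
      if "B' \<in> sets borel" "B' \<subseteq> B" "C' \<in> sets borel" "C' \<subseteq> C" for B' C'
    proof (cases "\<mu> B' \<ge> 0 \<and> \<mu> C' \<ge> 0")
      case True
      then have "ennreal (\<mu> B') + ennreal (\<mu> C') = ennreal (\<mu> (B' \<union> C'))"
        using that \<open>B \<inter> C = {}\<close> by (subst two) (auto simp: ennreal_plus)
      then show ?thesis
        using p_ge[of "B' \<union> C'" "B \<union> C"] that by auto
    next
      case False
      then have "ennreal (\<mu> B') + ennreal (\<mu> C') = ennreal (\<mu> B') \<or>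
                 ennreal (\<mu> B') + ennreal (\<mu> C') = ennreal (\<mu> C')"
        by (auto simp: ennreal_neg)
      then show ?thesis
        using p_ge[OF that(1) le_supI1[OF that(2)]] p_ge[OF that(3) le_supI2[OF that(4)]] by auto
    qed
    note bound = this
    have "(SUP B'\<in>{B'\<in>sets borel. B' \<subseteq> B}. ennreal (\<mu> B') + p C) \<le> p (B \<union> C)"
    proof (rule SUP_least, clarify)
      fix B' assume B': "B' \<in> sets borel" "B' \<subseteq> B"
      have "ennreal (\<mu> B') + p C = (SUP C'\<in>{C'\<in>sets borel. C' \<subseteq> C}. ennreal (\<mu> B') + ennreal (\<mu> C'))"
        unfolding p_def by (rule ennreal_SUP_add_right[OF nonempty])
      also have "\<dots> \<le> p (B \<union> C)"
        using bound B' by (auto intro!: SUP_least)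
      finally show "ennreal (\<mu> B') + p C \<le> p (B \<union> C)" .
    qed
    then show ?thesis
      unfolding ennreal_SUP_add_left[OF nonempty] p_def[of B, symmetric] .
  qed
  have fin: "(\<Sum>i<n. p (F i)) \<le> p (\<Union>i<n. F i)" if "disjoint_family F"
    for F :: "nat \<Rightarrow> 'a set" and n
  proof (induction n)
    case (Suc n)
    have "(\<Union>i<n. F i) \<inter> F n = {}"
    proof -
      have "F i \<inter> F n = {}" if "i < n" for i
        using \<open>disjoint_family F\<close> that by (intro disjoint_family_onD[where I = UNIV]) auto
      then show ?thesis
        by blast
    qed
    then have "p (\<Union>i<n. F i) + p (F n) \<le> p ((\<Union>i<n. F i) \<union> F n)"
      by (rule add)
    moreover have "(\<Union>i<n. F i) \<union> F n = (\<Union>i<Suc n. F i)"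
      by (auto simp: less_Suc_eq)
    ultimately show ?case
      using order_trans[OF add_right_mono[OF Suc, of "p (F n)"]] by simp
  qed simp
  have "countably_additive (sets borel) p"
  proof (rule countably_additiveI)
    fix F :: "nat \<Rightarrow> 'a set"
    assume F: "range F \<subseteq> sets borel" "disjoint_family F"
    show "(\<Sum>i. p (F i)) = p (\<Union>i. F i)"
    proof (rule antisym)
      have "(\<Sum>i<n. p (F i)) \<le> p (\<Union>i. F i)" for n
      proof -
        have "p (\<Union>i<n. F i) \<le> p (\<Union>i. F i)"
          unfolding p_def by (rule SUP_subset_mono) auto
        then show ?thesis
          using fin[OF F(2), of n] by simp
      qed
      then show "(\<Sum>i. p (F i)) \<le> p (\<Union>i. F i)"
        by (rule suminf_le_const[OF summableI])
      show "p (\<Union>i. F i) \<le> (\<Sum>i. p (F i))"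
        unfolding p_def[of "\<Union>i. F i"]
      proof (rule SUP_least, clarify)
        fix B :: "'a set" assume B: "B \<in> sets borel" "B \<subseteq> (\<Union>i. F i)"
        have "(\<lambda>i. \<mu> (B \<inter> F i)) sums \<mu> (\<Union>i. B \<inter> F i)"
          using F B by (intro sums) (auto simp: disjoint_family_on_def)
        moreover have "(\<Union>i. B \<inter> F i) = B"
          using B by auto
        ultimately have lim: "(\<lambda>n. \<Sum>i<n. \<mu> (B \<inter> F i)) \<longlonglongrightarrow> \<mu> B"
          by (simp add: sums_def)
        have "ennreal (\<Sum>i<n. \<mu> (B \<inter> F i)) \<le> (\<Sum>i. p (F i))" for n
        proof -
          have "ennreal (\<Sum>i<n. \<mu> (B \<inter> F i)) \<le> ennreal (\<Sum>i<n. max 0 (\<mu> (B \<inter> F i)))"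
            by (intro ennreal_leI sum_mono) auto
          also have "\<dots> = (\<Sum>i<n. ennreal (\<mu> (B \<inter> F i)))"
            by (simp add: sum_ennreal[symmetric] ennreal_max_0 del: sum_ennreal)
          also have "\<dots> \<le> (\<Sum>i<n. p (F i))"
            using F B by (intro sum_mono p_ge) auto
          also have "\<dots> \<le> (\<Sum>i. p (F i))"
            by (intro sum_le_suminf summableI) auto
          finally show ?thesis .
        qed
        then show "ennreal (\<mu> B) \<le> (\<Sum>i. p (F i))"
          by (intro LIMSEQ_le_const2[OF tendsto_ennrealI[OF lim]]) auto
      qed
    qed
  qed
  moreover have "positive (sets borel) p"
    by (simp add: positive_def p_def empty)
  moreover have "sigma_algebra UNIV (sets (borel :: 'a measure))"
    using sets.sigma_algebra_axioms[of "borel :: 'a measure"] by simp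
  ultimately have "emeasure (measure_of UNIV (sets borel) p) A = p A"
    using A by (intro emeasure_measure_of_sigma)
  then show ?thesis
    by (simp add: pos_part_measure_def p_def[abs_def])
qed

text \<open>
  Integrals of signed integrands may be infinite, so convolutions take values in \<^typ>\<open>ereal\<close>.
  Where the integral is undefined, the difference \<open>\<infinity> - \<infinity>\<close> is \<open>\<infinity>\<close>, so such points belong to
  every level set below. There the convolution of \<open>\<bar>v\<bar>\<close> is \<open>\<infinity>\<close> too, if the kernel is nonnegative.
\<close>

definition conv_fun ::
    "'a::topological_group_add measure \<Rightarrow> ('a \<Rightarrow> real) \<Rightarrow> ('a \<Rightarrow> real) \<Rightarrow> 'a \<Rightarrow> ereal" where
  "conv_fun M h f x =
     enn2ereal (\<integral>\<^sup>+ y. ennreal (f (- y + x) * h y) \<partial>M)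
     - enn2ereal (\<integral>\<^sup>+ y. ennreal (- (f (- y + x) * h y)) \<partial>M)"

definition conv_meas ::
    "('a::topological_group_add set \<Rightarrow> real) \<Rightarrow> ('a \<Rightarrow> real) \<Rightarrow> 'a \<Rightarrow> ereal" where
  "conv_meas \<mu> f x =
     enn2ereal ((\<integral>\<^sup>+ y. ennreal (f (- y + x)) \<partial>pos_part_measure \<mu>)
                + (\<integral>\<^sup>+ y. ennreal (- f (- y + x)) \<partial>neg_part_measure \<mu>))
     - enn2ereal ((\<integral>\<^sup>+ y. ennreal (- f (- y + x)) \<partial>pos_part_measure \<mu>)
                + (\<integral>\<^sup>+ y. ennreal (f (- y + x)) \<partial>neg_part_measure \<mu>))"

definition maximal_fun ::
    "'a::topological_group_add measure \<Rightarrow> 'i set \<Rightarrow> ('i \<Rightarrow> 'a \<Rightarrow> real) \<Rightarrow> ('a \<Rightarrow> real) \<Rightarrow> 'a \<Rightarrow> ereal"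
  where "maximal_fun M I k f x = (SUP \<beta>\<in>I. \<bar>conv_fun M f (k \<beta>) x\<bar>)"

definition maximal_meas ::
    "'i set \<Rightarrow> ('i \<Rightarrow> 'a::topological_group_add \<Rightarrow> real) \<Rightarrow> ('a set \<Rightarrow> real) \<Rightarrow> 'a \<Rightarrow> ereal"
  where "maximal_meas I k \<mu> x = (SUP \<beta>\<in>I. \<bar>conv_meas \<mu> (k \<beta>) x\<bar>)"

text \<open>
  For an uncountable family and a signed argument the level sets need not be measurable; outer
  measure avoids the default value \<open>0\<close> of \<^const>\<open>emeasure\<close> and agrees with it on Borel sets.
\<close>

definition weak_type_fun ::
    "'a::topological_group_add measure \<Rightarrow> 'i set \<Rightarrow> ('i \<Rightarrow> 'a \<Rightarrow> real) \<Rightarrow> real \<Rightarrow> bool" where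
  "weak_type_fun M I k c \<longleftrightarrow>
     (\<forall>f::'a \<Rightarrow> real. integrable M f \<longrightarrow>
        (\<forall>\<alpha>>0. ennreal \<alpha> * outer_measure_of M {x. maximal_fun M I k f x > ereal \<alpha>}
                \<le> ennreal (c * (\<integral>x. \<bar>f x\<bar> \<partial>M))))"

definition weak_type_meas ::
    "'a::topological_group_add measure \<Rightarrow> 'i set \<Rightarrow> ('i \<Rightarrow> 'a \<Rightarrow> real) \<Rightarrow> real \<Rightarrow> bool" where
  "weak_type_meas M I k c \<longleftrightarrow>
     (\<forall>\<mu>::'a set \<Rightarrow> real. radon_real_measure \<mu> \<longrightarrow>
        (\<forall>\<alpha>>0. ennreal \<alpha> * outer_measure_of M {x. maximal_meas I k \<mu> x > ereal \<alpha>}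
                \<le> ennreal c * total_variation \<mu> UNIV))"

end

theory Submission
  imports Defs
begin

text \<open>
  An integrable function \<open>f\<close> is the Radon measure \<open>f d\<lambda>\<close>, whose total variation is \<open>\<parallel>f\<parallel>\<^sub>1\<close> and
  whose convolutions are those of \<open>f\<close>. So the inequality for measures contains the one for functions
  (\<open>weak_type_fun_if_meas\<close>).

  For the converse, \<open>\<bar>\<mu> * k\<bar> \<le> \<bar>\<mu>\<bar> * k\<close> reduces the claim to a finite positive Radon measure \<open>\<nu>\<close>
  (\<open>weak_type_meas_if_positive\<close>). If the kernels are lower semicontinuous, the set \<open>{k\<^sup>* \<nu> > \<alpha>}\<close> is
  open and only its compact subsets \<open>K\<close> matter. At a point of \<open>K\<close> the integral defining \<open>\<nu> * k\<close> exceeds \<open>\<alpha>\<close>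
  already for a simple function with compact level sets strictly below the kernel. Lower
  semicontinuity makes this stable under small translations, and compactness of \<open>K\<close> makes it
  uniform. Hence \<open>\<nu>\<close> can be replaced by finitely many point masses, and these by normalized indicators of
  small sets: there is an integrable \<open>f \<ge> 0\<close> with \<open>\<parallel>f\<parallel>\<^sub>1 \<le> \<nu>(X)\<close> and \<open>k\<^sup>* f > \<alpha>\<close> on \<open>K\<close>
  (\<open>convolution_discretization\<close>, \<open>convolution_step_function\<close>). The inequality for \<open>f\<close> bounds \<open>\<lambda>(K)\<close>.

  A sequence of Borel kernels is majorized by lower semicontinuous kernels with an error that is
  dominated by one lower semicontinuous function \<open>H\<close> with small integral (\<open>lsc_majorant\<close>). The function \<open>f\<close>
  obtained for the majorants also works for the original kernels, except where \<open>f * H\<close> is not small.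
  That set has small measure (\<open>lsc_convolution_weak_type\<close>). Measurability of \<open>{k\<^sup>* \<nu> > \<alpha>}\<close>
  (\<open>convolution_measurable\<close>) again reduces the claim to compact subsets. Countability of the family is used
  to sum the errors and for this measurability.

  The group need not be second countable, so a Borel function on its square need not be measurable for the
  product \<open>\<sigma>\<close>-algebra, and Tonelli's theorem does not apply to it. The discretization takes its place.
\<close>

section \<open>Inner regular measures\<close>

text \<open>
  Haar measure, finite Radon measures and the measures \<open>f d\<lambda>\<close> all share this property, so the
  approximation lemmas are proved once for it; finiteness is assumed where it is used.
\<close>

definition inner_regular :: "'a::topological_space measure \<Rightarrow> bool" where
  "inner_regular M \<longleftrightarrow>
     sets M = sets borel \<and>
     (\<forall>A\<in>sets borel. emeasure M A = (SUP K\<in>{K. compact K \<and> K \<subseteq> A}. emeasure M K))"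

lemma inner_regular_sets: "inner_regular M \<Longrightarrow> sets M = sets borel"
  by (simp add: inner_regular_def)

lemma inner_regular_space: "inner_regular M \<Longrightarrow> space M = UNIV"
  using sets_eq_imp_space_eq[of M borel] by (simp add: inner_regular_def)

lemma compact_in_borel: "compact K \<Longrightarrow> K \<in> sets borel" for K :: "'a::t2_space set"
  by (intro borel_closed compact_imp_closed)

text \<open>
  The supremum over compact sets is a supremum over a sequence of them; its finite unions
  increase and exhaust \<open>A\<close> up to a null set.
\<close>

lemma inner_regular_exhaustion:
  fixes M :: "'a::t2_space measure"
  assumes M: "inner_regular M" and A: "A \<in> sets borel" and fin: "emeasure M A < \<infinity>"
  obtains C :: "nat \<Rightarrow> 'a set"
  where "\<And>n. compact (C n)" "\<And>n. C n \<subseteq> A" "incseq C" "emeasure M (A - (\<Union>n. C n)) = 0"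
proof -
  note [simp] = inner_regular_sets[OF M]
  have eq: "emeasure M A = Sup (emeasure M ` {K. compact K \<and> K \<subseteq> A})"
    using M A by (simp add: inner_regular_def)
  obtain f :: "nat \<Rightarrow> ennreal" where f: "range f \<subseteq> emeasure M ` {K. compact K \<and> K \<subseteq> A}"
      "emeasure M A = (SUP i. f i)"
    using ennreal_Sup_countable_SUP[of "emeasure M ` {K. compact K \<and> K \<subseteq> A}"] eq by auto
  have "\<exists>K. compact K \<and> K \<subseteq> A \<and> f i = emeasure M K" for i
    using f(1) by (auto simp: image_subset_iff)
  then obtain K where K: "\<And>i. compact (K i)" "\<And>i. K i \<subseteq> A" "\<And>i. f i = emeasure M (K i)"
    by metis
  define C where "C n = (\<Union>i\<le>n. K i)" for n
  have comp: "compact (C n)" for n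
    unfolding C_def using K by (intro compact_UN) auto
  have sub: "C n \<subseteq> A" for n
    unfolding C_def using K by auto
  have inc: "incseq C"
    unfolding C_def incseq_def by (auto intro: order_trans)
  have U: "(\<Union>n. C n) \<in> sets borel"
    using comp compact_in_borel by (intro sets.countable_UN) auto
  have Ufin: "emeasure M (\<Union>n. C n) \<le> emeasure M A"
    using sub A U by (intro emeasure_mono) auto
  have "emeasure M A \<le> emeasure M (\<Union>n. C n)"
    unfolding f(2) using U K(3)
    by (auto intro!: SUP_least emeasure_mono simp: C_def)
  then have "emeasure M (\<Union>n. C n) = emeasure M A"
    using Ufin by (rule antisym[rotated])
  then have "emeasure M (A - (\<Union>n. C n)) = emeasure M A - emeasure M A"
    using fin A U sub by (subst emeasure_Diff) auto
  also have "\<dots> = 0"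
    using fin by simp
  finally show ?thesis
    using that comp sub inc by blast
qed

lemma ennreal_less_contract:
  fixes a x :: ennreal
  assumes "a < x"
  obtains r :: real where "0 < r" "r < 1" "a < ennreal r * x"
proof (cases x)
  case top
  with assms that[of "1/2"] show ?thesis
    by (auto simp: ennreal_mult_top)
next
  case (real x')
  with assms obtain a' where a: "a = ennreal a'" "0 \<le> a'" "a' < x'"
    by (cases a) (auto simp: ennreal_less_iff)
  have "a' / x' < 1" "0 \<le> a' / x'"
    using a by (auto simp: divide_simps)
  moreover from this obtain r where "a' / x' < r" "r < 1"
    using dense by metis
  ultimately have r: "a' / x' < r" "r < 1" "0 < r"
    by linarith+
  then have "a' < r * x'"
    using a by (auto simp: divide_simps split: if_splits)
  with r that[of r] real a show ?thesis
    by (auto simp: ennreal_less_iff simp flip: ennreal_mult)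
qed

text \<open>
  A function whose integral exceeds \<open>\<alpha>\<close> has a simple minorant with the same property whose nonzero
  level sets are compact and which is strictly smaller where it is nonzero. Strictness
  and compactness are what make the bound \<open>s y < g y\<close> survive small translations.
\<close>

lemma compact_simple_minorant:
  fixes \<nu> :: "'a::t2_space measure" and g :: "'a \<Rightarrow> ennreal"
  assumes \<nu>: "inner_regular \<nu>" and fin: "emeasure \<nu> UNIV < \<infinity>"
    and g [measurable]: "g \<in> borel_measurable borel" and less: "\<alpha> < (\<integral>\<^sup>+y. g y \<partial>\<nu>)"
  obtains s :: "'a \<Rightarrow> ennreal" where "s \<in> borel_measurable borel" "finite (range s)"
    "\<And>a. a \<noteq> 0 \<Longrightarrow> compact (s -` {a})" "\<And>y. s y \<noteq> 0 \<Longrightarrow> s y < g y" "\<alpha> < (\<integral>\<^sup>+y. s y \<partial>\<nu>)"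
proof -
  note [measurable_cong] = inner_regular_sets[OF \<nu>]
  note [simp] = inner_regular_space[OF \<nu>] inner_regular_sets[OF \<nu>]
  have finA: "emeasure \<nu> A < \<infinity>" if "A \<in> sets borel" for A
    using emeasure_mono[of A UNIV \<nu>] fin by (auto intro: le_less_trans)
  \<comment> \<open>Shrinking by \<open>r < 1\<close> leaves the room needed for the strict inequality.\<close>
  obtain r where r: "0 < r" "r < 1" "\<alpha> < ennreal r * (\<integral>\<^sup>+y. g y \<partial>\<nu>)"
    using ennreal_less_contract[OF less] .
  then have "\<alpha> < (\<integral>\<^sup>+y. ennreal r * g y \<partial>\<nu>)"
    by (subst nn_integral_cmult) auto
  then obtain t where t: "simple_function \<nu> t" "\<And>y. t y \<le> ennreal r * g y" "\<And>y. t y < top"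
      "\<alpha> < integral\<^sup>S \<nu> t"
    unfolding nn_integral_def_finite by (auto simp: less_SUP_iff le_fun_def)
  have tm [measurable]: "t \<in> borel_measurable borel"
    using borel_measurable_simple_function[OF t(1)] by (simp add: measurable_cong_sets[OF inner_regular_sets[OF \<nu>] refl])
  have int_t: "\<alpha> < (\<integral>\<^sup>+y. t y \<partial>\<nu>)"
    using t by (simp add: nn_integral_eq_simple_integral)
  have strict: "t y < g y" if "t y \<noteq> 0" for y
  proof (cases "g y")
    case top
    then show ?thesis using t(3)[of y] by simp
  next
    case (real b)
    have "t y \<le> ennreal (r * b)"
      using t(2)[of y] real r by (simp add: ennreal_mult)
    moreover have "b \<noteq> 0"
      using that t(2)[of y] real by auto
    ultimately show ?thesis
      using real r by (auto intro!: le_less_trans[of "t y"] ennreal_lessI)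
  qed
  have fr: "finite (range t)"
    using simple_functionD(1)[OF t(1)] by simp
  have "\<exists>C :: nat \<Rightarrow> 'a set. (\<forall>n. compact (C n)) \<and> (\<forall>n. C n \<subseteq> t -` {a}) \<and> incseq C \<and>
      emeasure \<nu> (t -` {a} - (\<Union>n. C n)) = 0" for a
  proof -
    have "t -` {a} \<in> sets borel"
      using measurable_sets[OF tm, of "{a}"] by simp
    from inner_regular_exhaustion[OF \<nu> this finA[OF this]] show ?thesis
      by metis
  qed
  then obtain C :: "ennreal \<Rightarrow> nat \<Rightarrow> 'a set" where C: "\<And>a n. compact (C a n)" "\<And>a n. C a n \<subseteq> t -` {a}"
      "\<And>a. incseq (C a)" "\<And>a. emeasure \<nu> (t -` {a} - (\<Union>n. C a n)) = 0"
    by metis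
  \<comment> \<open>Each nonzero level set of \<open>t\<close> is exhausted by compact sets; cutting \<open>t\<close> down to \<open>D n\<close> loses little.\<close>
  define D where "D n = (\<Union>a\<in>range t - {0}. C a n)" for n
  have Dm [measurable]: "D n \<in> sets borel" for n
    unfolding D_def by (intro sets.finite_UN compact_in_borel C(1)) (use fr in auto)
  have mono: "indicator (D n) y \<le> (indicator (D (Suc n)) y :: ennreal)" for n y
  proof -
    have "D n \<subseteq> D (Suc n)"
      unfolding D_def using C(3) by (intro UN_mono) (auto simp: incseq_Suc_iff)
    then show ?thesis
      by (auto split: split_indicator)
  qed
  have AE1: "AE y in \<nu>. \<forall>a\<in>range t. y \<in> t -` {a} \<longrightarrow> y \<in> (\<Union>n. C a n)"
  proof (intro AE_finite_allI fr)
    fix a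
    have "(\<Union>n. C a n) \<in> sets borel"
      by (intro sets.countable_UN) (auto intro: compact_in_borel C(1))
    moreover have "t -` {a} \<in> sets borel"
      using measurable_sets[OF tm, of "{a}"] by simp
    ultimately show "AE y in \<nu>. y \<in> t -` {a} \<longrightarrow> y \<in> (\<Union>n. C a n)"
      using C(4)[of a] by (intro AE_I[where N = "t -` {a} - (\<Union>n. C a n)"]) auto
  qed
  then have AE2: "AE y in \<nu>. t y = (SUP n. t y * indicator (D n) y)"
  proof eventually_elim
    case (elim y)
    show ?case
    proof (cases "t y = 0")
      case False
      with elim obtain n where "y \<in> C (t y) n" by auto
      with False have "y \<in> D n" by (auto simp: D_def)
      then have "t y \<le> (SUP n. t y * indicator (D n) y)"
        by (intro SUP_upper2[of n]) auto
      then show ?thesis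
        by (intro antisym SUP_least) (auto split: split_indicator)
    qed simp
  qed
  have "(\<integral>\<^sup>+y. t y \<partial>\<nu>) = (\<integral>\<^sup>+y. (SUP n. t y * indicator (D n) y) \<partial>\<nu>)"
    using AE2 by (rule nn_integral_cong_AE)
  also have "\<dots> = (SUP n. \<integral>\<^sup>+y. t y * indicator (D n) y \<partial>\<nu>)"
    using mono by (intro nn_integral_monotone_convergence_SUP)
      (auto simp: incseq_Suc_iff le_fun_def intro!: mult_left_mono)
  finally obtain n where n: "\<alpha> < (\<integral>\<^sup>+y. t y * indicator (D n) y \<partial>\<nu>)"
    using int_t by (auto simp: less_SUP_iff)
  show ?thesis
  proof (rule that[of "\<lambda>y. t y * indicator (D n) y"])
    have "range (\<lambda>y. t y * indicator (D n) y) \<subseteq> insert 0 (range t)"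
      by (auto split: split_indicator)
    then show "finite (range (\<lambda>y. t y * indicator (D n) y))"
      using fr by (rule finite_subset[OF _ finite.insertI])
    show "compact ((\<lambda>y. t y * indicator (D n) y) -` {a})" if "a \<noteq> 0" for a
    proof -
      have in_D: "y \<in> D n \<longleftrightarrow> y \<in> C (t y) n" if "t y \<noteq> 0" for y
      proof
        assume "y \<in> D n"
        then obtain a where "y \<in> C a n" by (auto simp: D_def)
        moreover from this have "t y = a" using C(2) by blast
        ultimately show "y \<in> C (t y) n" by simp
      qed (use that in \<open>auto simp: D_def\<close>)
      have "(\<lambda>y. t y * indicator (D n) y) -` {a} = C a n"
      proof (intro set_eqI iffI)
        fix y assume y: "y \<in> (\<lambda>y. t y * indicator (D n) y) -` {a}"
        with \<open>a \<noteq> 0\<close> have "y \<in> D n" "t y = a"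
          by (auto split: split_indicator_asm)
        then show "y \<in> C a n"
          using in_D \<open>a \<noteq> 0\<close> by auto
      next
        fix y assume y: "y \<in> C a n"
        then have "t y = a" using C(2) by blast
        then show "y \<in> (\<lambda>y. t y * indicator (D n) y) -` {a}"
          using in_D[of y] y \<open>a \<noteq> 0\<close> by auto
      qed
      then show ?thesis
        using C(1) by simp
    qed
    show "t y * indicator (D n) y < g y" if "t y * indicator (D n) y \<noteq> 0" for y
      using that strict[of y] by (auto split: split_indicator_asm)
    show "(\<lambda>y. t y * indicator (D n) y) \<in> borel_measurable borel"
      by measurable
    show "\<alpha> < (\<integral>\<^sup>+y. t y * indicator (D n) y \<partial>\<nu>)"
      by (rule n)
  qed
qed

section \<open>Lower semicontinuous kernels and discretization\<close>

text \<open>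
  The version of \<^const>\<open>lower_semicontinuous\<close> for functions that may be infinite; the majorants
  of Borel kernels constructed below can take the value \<open>\<infinity>\<close>.
\<close>

definition lsc :: "('a::topological_space \<Rightarrow> ennreal) \<Rightarrow> bool" where
  "lsc k \<longleftrightarrow> (\<forall>a. open {x. a < k x})"

lemma lsc_borel_measurable: "lsc k \<Longrightarrow> k \<in> borel_measurable borel"
  by (intro borel_measurableI_greater) (simp add: lsc_def)

lemma lsc_SUP: "(\<And>i. i \<in> I \<Longrightarrow> lsc (k i)) \<Longrightarrow> lsc (\<lambda>x. SUP i\<in>I. k i x)"
  unfolding lsc_def less_SUP_iff Collect_bex_eq by (intro allI open_UN) simp

lemma lsc_const_indicator: "open A \<Longrightarrow> lsc (\<lambda>x. b * indicator A x)"
proof -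
  assume "open A"
  moreover have "{x. a < b * indicator A x} = (if a < b then A else {})" for a
    by (auto split: split_indicator)
  ultimately show ?thesis by (simp add: lsc_def)
qed

lemma lsc_ennreal:
  assumes "\<And>x. k x \<ge> 0" and k: "lower_semicontinuous k"
  shows "lsc (\<lambda>x. ennreal (k x))"
  unfolding lsc_def
proof
  fix a
  show "open {x. a < ennreal (k x)}"
  proof (cases a)
    case (real r)
    then have "{x. a < ennreal (k x)} = {x. r < k x}"
      using assms by (auto simp: ennreal_less_iff)
    with k show ?thesis by (simp add: lower_semicontinuous_def)
  qed simp
qed

text \<open>
  The strict bound \<open>s y < k (- y + x)\<close> is an open condition in \<open>y\<close> and \<open>x\<close>. On the compact level
  sets of \<open>s\<close> it therefore holds with one neighbourhood \<open>V\<close> of perturbations of \<open>y\<close> and one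
  neighbourhood \<open>W\<close> of \<open>x\<close> (a tube argument).
\<close>

lemma lsc_simple_minorant_nbhd:
  fixes k s :: "'a::topological_group_add \<Rightarrow> ennreal"
  assumes k: "lsc k" and fin: "finite (range s)"
    and comp: "\<And>a. a \<noteq> 0 \<Longrightarrow> compact (s -` {a})"
    and less: "\<And>y. s y \<noteq> 0 \<Longrightarrow> s y < k (- y + x)"
  obtains V W where "open V" "0 \<in> V" "open W" "x \<in> W"
    "\<And>y v w. s y \<noteq> 0 \<Longrightarrow> v \<in> V \<Longrightarrow> w \<in> W \<Longrightarrow> s y < k (- (y + v) + w)"
proof -
  have "eventually (\<lambda>(v, w). \<forall>y\<in>s -` {a}. a < k (- (y + v) + w)) (nhds 0 \<times>\<^sub>F nhds x)"
    if a: "a \<noteq> 0" for a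
  proof -
    have cover: "\<exists>Y V W. open Y \<and> y \<in> Y \<and> open V \<and> 0 \<in> V \<and> open W \<and> x \<in> W \<and>
        (\<forall>y\<in>Y. \<forall>v\<in>V. \<forall>w\<in>W. a < k (- (y + v) + w))" if y: "y \<in> s -` {a}" for y
    proof -
      have T: "(fst \<longlongrightarrow> y) (nhds (y, 0, x))" "((\<lambda>p. fst (snd p)) \<longlongrightarrow> 0) (nhds (y, 0, x))"
          "((\<lambda>p. snd (snd p)) \<longlongrightarrow> x) (nhds (y, 0, x))"
        using tendsto_fst[OF filterlim_ident, of "(y, 0, x)"] tendsto_snd[OF filterlim_ident, of "(y, 0, x)"]
          tendsto_fst[OF tendsto_snd[OF filterlim_ident], of "(y, 0, x)"]
          tendsto_snd[OF tendsto_snd[OF filterlim_ident], of "(y, 0, x)"] by simp_all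
      have "((\<lambda>p. - (fst p + fst (snd p)) + snd (snd p)) \<longlongrightarrow> - (y + 0) + x) (nhds (y, 0, x))"
        by (intro tendsto_add tendsto_minus T)
      moreover have "open {z. a < k z}" "- (y + 0) + x \<in> {z. a < k z}"
        using k less[of y] y a by (auto simp: lsc_def)
      ultimately have "eventually (\<lambda>p. - (fst p + fst (snd p)) + snd (snd p) \<in> {z. a < k z}) (nhds (y, 0, x))"
        by (rule topological_tendstoD)
      then obtain S where S: "open S \<and> (y, 0, x) \<in> S \<and> (\<forall>p\<in>S. - (fst p + fst (snd p)) + snd (snd p) \<in> {z. a < k z})"
        unfolding eventually_nhds ..
      have "\<exists>Y T. open Y \<and> open T \<and> (y, 0, x) \<in> Y \<times> T \<and> Y \<times> T \<subseteq> S"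
        using S open_prod_elim by metis
      then obtain Y T where YT: "open Y" "open T" "y \<in> Y" "(0, x) \<in> T" "Y \<times> T \<subseteq> S"
        by auto
      have "\<exists>V W. open V \<and> open W \<and> (0, x) \<in> V \<times> W \<and> V \<times> W \<subseteq> T"
        using YT(2,4) open_prod_elim by metis
      then obtain V W where VW: "open V" "open W" "0 \<in> V" "x \<in> W" "V \<times> W \<subseteq> T"
        by auto
      from YT VW have "open Y" "y \<in> Y" "open V" "0 \<in> V" "open W" "x \<in> W"
          "Y \<times> V \<times> W \<subseteq> S"
        by auto
      moreover have "a < k (- (y' + v) + w)" if "y' \<in> Y" "v \<in> V" "w \<in> W" for y' v w
      proof -
        have "(y', v, w) \<in> S" using YT(5) VW(5) that by auto
        with S have "- (fst (y', v, w) + fst (snd (y', v, w))) + snd (snd (y', v, w)) \<in> {z. a < k z}"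
          by blast
        then show ?thesis by simp
      qed
      ultimately show ?thesis
        by (intro exI[of _ Y] exI[of _ V] exI[of _ W]) simp
    qed
    then obtain Y V W where YVW: "\<And>y. y \<in> s -` {a} \<Longrightarrow> open (Y y) \<and> y \<in> Y y \<and> open (V y) \<and> 0 \<in> V y \<and>
        open (W y) \<and> x \<in> W y \<and> (\<forall>y'\<in>Y y. \<forall>v\<in>V y. \<forall>w\<in>W y. a < k (- (y' + v) + w))"
      by metis
    obtain F where F: "F \<subseteq> s -` {a}" "finite F" "s -` {a} \<subseteq> (\<Union>y\<in>F. Y y)"
      using compactE_image[OF comp[OF a], of "s -` {a}" Y] YVW by blast
    have "\<forall>\<^sub>F v in nhds 0. \<forall>y\<in>F. v \<in> V y" "\<forall>\<^sub>F w in nhds x. \<forall>y\<in>F. w \<in> W y"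
      using F(1,2) YVW by (auto simp: eventually_ball_finite_distrib intro!: eventually_nhds_in_open)
    then have "\<forall>\<^sub>F p in nhds 0 \<times>\<^sub>F nhds x. (\<forall>y\<in>F. fst p \<in> V y) \<and> (\<forall>y\<in>F. snd p \<in> W y)"
      by (rule eventually_prodI)
    then show ?thesis
    proof (rule eventually_mono)
      fix p assume p: "(\<forall>y\<in>F. fst p \<in> V y) \<and> (\<forall>y\<in>F. snd p \<in> W y)"
      have "a < k (- (y + fst p) + snd p)" if y: "y \<in> s -` {a}" for y
      proof -
        obtain y' where "y' \<in> F" "y \<in> Y y'"
          using y F(3) by auto
        then show ?thesis
          using YVW[of y'] F(1) p by blast
      qed
      then show "case p of (v, w) \<Rightarrow> \<forall>y\<in>s -` {a}. a < k (- (y + v) + w)"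
        by (cases p) simp
    qed
  qed
  then have "\<forall>a\<in>range s - {0}. eventually (\<lambda>(v, w). \<forall>y\<in>s -` {a}. a < k (- (y + v) + w)) (nhds 0 \<times>\<^sub>F nhds x)"
    by blast
  then have "eventually (\<lambda>p. \<forall>a\<in>range s - {0}. case p of (v, w) \<Rightarrow> \<forall>y\<in>s -` {a}. a < k (- (y + v) + w)) (nhds 0 \<times>\<^sub>F nhds x)"
    using fin by (intro eventually_ball_finite) auto
  then obtain P Q where PQ: "eventually P (nhds 0)" "eventually Q (nhds x)"
      "\<forall>v w. P v \<longrightarrow> Q w \<longrightarrow> (\<forall>a\<in>range s - {0}. case (v, w) of (v, w) \<Rightarrow> \<forall>y\<in>s -` {a}. a < k (- (y + v) + w))"
    unfolding eventually_prod_filter by (elim exE conjE) (rule that, assumption+)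
  obtain V where V: "open V" "0 \<in> V" "\<And>v. v \<in> V \<Longrightarrow> P v"
    using PQ(1) by (auto simp: eventually_nhds)
  obtain W where W: "open W" "x \<in> W" "\<And>w. w \<in> W \<Longrightarrow> Q w"
    using PQ(2) by (auto simp: eventually_nhds)
  show ?thesis
  proof (rule that[OF V(1,2) W(1,2)])
    fix y v w assume "s y \<noteq> 0" "v \<in> V" "w \<in> W"
    then show "s y < k (- (y + v) + w)"
      using PQ(3) V(3) W(3) by auto
  qed
qed

lemma continuous_on_inverse_translate:
  "continuous_on UNIV (\<lambda>y. - y + x)" "continuous_on UNIV (\<lambda>x. - y + x)" "continuous_on UNIV (\<lambda>x. y + x)"
  for x y :: "'a::topological_group_add"
  unfolding continuous_on_def by (auto intro!: tendsto_add tendsto_minus)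

lemma measurable_inverse_translate [measurable]:
  "(\<lambda>y. - y + x) \<in> borel_measurable borel" "(\<lambda>x. - y + x) \<in> borel_measurable borel" "(\<lambda>x. y + x) \<in> borel_measurable borel"
  for x y :: "'a::topological_group_add"
  by (intro borel_measurable_continuous_onI continuous_on_inverse_translate)+

lemma lsc_convolution:
  fixes \<nu> :: "'a::{topological_group_add, t2_space} measure"
  assumes \<nu>: "inner_regular \<nu>" and fin: "emeasure \<nu> UNIV < \<infinity>" and k: "lsc k"
  shows "lsc (\<lambda>x. \<integral>\<^sup>+y. k (- y + x) \<partial>\<nu>)"
  unfolding lsc_def
proof
  fix \<alpha>
  note [measurable] = lsc_borel_measurable[OF k]
  show "open {x. \<alpha> < (\<integral>\<^sup>+y. k (- y + x) \<partial>\<nu>)}"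
  proof (subst open_subopen, intro ballI)
    fix x assume "x \<in> {x. \<alpha> < (\<integral>\<^sup>+y. k (- y + x) \<partial>\<nu>)}"
    then have "\<alpha> < (\<integral>\<^sup>+y. k (- y + x) \<partial>\<nu>)"
      by simp
    then obtain s where s: "s \<in> borel_measurable borel" "finite (range s)"
        "\<And>a. a \<noteq> 0 \<Longrightarrow> compact (s -` {a})" "\<And>y. s y \<noteq> 0 \<Longrightarrow> s y < k (- y + x)" "\<alpha> < (\<integral>\<^sup>+y. s y \<partial>\<nu>)"
      by (rule compact_simple_minorant[OF \<nu> fin, rotated]) measurable
    obtain V W where VW: "open V" "0 \<in> V" "open W" "x \<in> W"
        "\<And>y v w. s y \<noteq> 0 \<Longrightarrow> v \<in> V \<Longrightarrow> w \<in> W \<Longrightarrow> s y < k (- (y + v) + w)"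
      using lsc_simple_minorant_nbhd[OF k s(2-4)] by metis
    have "\<alpha> < (\<integral>\<^sup>+y. k (- y + w) \<partial>\<nu>)" if "w \<in> W" for w
    proof -
      have "s y \<le> k (- y + w)" for y
        using VW(5)[of y 0 w] VW(2) that by (cases "s y = 0") auto
      then show ?thesis
        using s(5) by (intro less_le_trans[OF s(5)] nn_integral_mono)
    qed
    then show "\<exists>T. open T \<and> x \<in> T \<and> T \<subseteq> {x. \<alpha> < (\<integral>\<^sup>+y. k (- y + x) \<partial>\<nu>)}"
      using VW(3,4) by blast
  qed
qed

text \<open>
  The substitute for Fubini's theorem, which is problematic here because the product of two
  Borel \<open>\<sigma>\<close>-algebras need not contain the open sets of the product space. Uniformly on a compact set,
  the measure \<open>\<nu>\<close> can be replaced by finitely many point masses \<open>c l\<close> at \<open>z l\<close>, which may even be spread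
  in any way over \<open>z l + U\<close>: this is why the infimum over \<open>U\<close> appears.
  
  The masses are \<open>c l = \<nu> (L l)\<close> for a partition of a compact set into small pieces \<open>L l\<close>. For
  \<open>y \<in> L l\<close> and \<open>u \<in> U\<close>, the point \<open>z l + u\<close> is \<open>y + v\<close> with \<open>v\<close> so close to \<open>0\<close> that
  \<open>s y\<close> still bounds the kernel there from below.
\<close>

lemma convolution_discretization:
  fixes \<nu> :: "'a::{topological_group_add, t2_space} measure" and k :: "'i \<Rightarrow> 'a \<Rightarrow> ennreal"
  assumes \<nu>: "inner_regular \<nu>" and fin: "emeasure \<nu> UNIV < \<infinity>" and k: "\<And>i. i \<in> I \<Longrightarrow> lsc (k i)"
    and K: "compact K" and large: "\<And>x. x \<in> K \<Longrightarrow> \<exists>i\<in>I. \<alpha> < (\<integral>\<^sup>+y. k i (- y + x) \<partial>\<nu>)"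
  obtains U and n :: nat and z :: "nat \<Rightarrow> 'a" and c :: "nat \<Rightarrow> ennreal"
  where "open U" "0 \<in> U" "(\<Sum>l<n. c l) \<le> emeasure \<nu> UNIV"
    "\<And>x. x \<in> K \<Longrightarrow> \<exists>i\<in>I. \<alpha> < (\<Sum>l<n. c l * (INF u\<in>U. k i (- (z l + u) + x)))"
proof -
  note [simp] = inner_regular_space[OF \<nu>] inner_regular_sets[OF \<nu>]
  note [measurable_cong] = inner_regular_sets[OF \<nu>]
  have "\<exists>i s V W. i \<in> I \<and> finite (range s) \<and> (\<forall>a. a \<noteq> 0 \<longrightarrow> compact (s -` {a})) \<and>
      \<alpha> < (\<integral>\<^sup>+y. s y \<partial>\<nu>) \<and> open V \<and> 0 \<in> V \<and> open W \<and> x \<in> W \<and>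
      (\<forall>y v w. s y \<noteq> 0 \<longrightarrow> v \<in> V \<longrightarrow> w \<in> W \<longrightarrow> s y < k i (- (y + v) + w))" if x: "x \<in> K" for x
  proof -
    obtain i where i: "i \<in> I" "\<alpha> < (\<integral>\<^sup>+y. k i (- y + x) \<partial>\<nu>)"
      using large[OF x] by auto
    note [measurable] = lsc_borel_measurable[OF k[OF i(1)]]
    obtain s where s: "s \<in> borel_measurable borel" "finite (range s)"
        "\<And>a. a \<noteq> 0 \<Longrightarrow> compact (s -` {a})" "\<And>y. s y \<noteq> 0 \<Longrightarrow> s y < k i (- y + x)" "\<alpha> < (\<integral>\<^sup>+y. s y \<partial>\<nu>)"
      using i(2) by (rule compact_simple_minorant[OF \<nu> fin, rotated]) measurable
    obtain V W where VW: "open V" "0 \<in> V" "open W" "x \<in> W"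
        "\<And>y v w. s y \<noteq> 0 \<Longrightarrow> v \<in> V \<Longrightarrow> w \<in> W \<Longrightarrow> s y < k i (- (y + v) + w)"
      using lsc_simple_minorant_nbhd[OF k[OF i(1)] s(2-4)] by metis
    show ?thesis
      using i(1) s VW by (intro exI[of _ i] exI[of _ s] exI[of _ V] exI[of _ W]) simp
  qed
  then obtain \<iota> s V W where sel: "\<And>x. x \<in> K \<Longrightarrow> \<iota> x \<in> I \<and> finite (range (s x)) \<and> (\<forall>a. a \<noteq> 0 \<longrightarrow> compact (s x -` {a})) \<and>
      \<alpha> < (\<integral>\<^sup>+y. s x y \<partial>\<nu>) \<and> open (V x) \<and> 0 \<in> V x \<and> open (W x) \<and> x \<in> W x \<and>
      (\<forall>y v w. s x y \<noteq> 0 \<longrightarrow> v \<in> V x \<longrightarrow> w \<in> W x \<longrightarrow> s x y < k (\<iota> x) (- (y + v) + w))"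
    by metis
  obtain X where X: "X \<subseteq> K" "finite X" "K \<subseteq> (\<Union>x\<in>X. W x)"
    using compactE_image[OF K, of K W] sel by blast
  define V0 where "V0 = (\<Inter>x\<in>X. V x)"
  have "open V0" "0 \<in> V0"
    using X(1,2) sel by (auto simp: V0_def intro!: open_INT)
  \<comment> \<open>A neighbourhood \<open>U\<close> of \<open>0\<close> with \<open>- U + U \<subseteq> V0\<close>.\<close>
  have lim: "((\<lambda>p::'a \<times> 'a. - fst p + snd p) \<longlongrightarrow> - 0 + 0) (nhds 0 \<times>\<^sub>F nhds 0)"
    by (intro tendsto_add tendsto_minus filterlim_fst filterlim_snd)
  have "eventually (\<lambda>p. - fst p + snd p \<in> V0) (nhds 0 \<times>\<^sub>F nhds 0)"
    using topological_tendstoD[OF lim \<open>open V0\<close>] \<open>0 \<in> V0\<close> by simp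
  then obtain P Q where PQ: "eventually P (nhds 0)" "eventually Q (nhds 0)"
      "\<forall>u u'. P u \<longrightarrow> Q u' \<longrightarrow> - fst (u, u') + snd (u, u') \<in> V0"
    unfolding eventually_prod_filter by (elim exE conjE) (rule that, assumption+)
  then have "eventually (\<lambda>u. P u \<and> Q u) (nhds 0)"
    by (intro eventually_conj)
  then obtain U where U: "open U" "0 \<in> U" "\<And>u. u \<in> U \<Longrightarrow> P u \<and> Q u"
    by (auto simp: eventually_nhds)
  have UV: "- u + u' \<in> V0" if "u \<in> U" "u' \<in> U" for u u'
    using PQ(3) U(3) that by auto
  define T where "T z = {y. - z + y \<in> U}" for z
  have openT: "open (T z)" for z
    using open_vimage[OF U(1) continuous_on_inverse_translate(2), of z] by (simp add: T_def vimage_def)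
  have zT: "z \<in> T z" for z
    using U(2) by (simp add: T_def)
  have Tm: "T z \<in> sets borel" for z
    using openT by simp
  define C where "C = (\<Union>x\<in>X. \<Union>a\<in>range (s x) - {0}. s x -` {a})"
  have "compact C"
    unfolding C_def using X sel by (intro compact_UN) auto
  then have [measurable]: "C \<in> sets borel"
    by (rule compact_in_borel)
  obtain Z where Z: "finite Z" "C \<subseteq> (\<Union>z\<in>Z. T z)"
    by (rule compactE_image[OF \<open>compact C\<close>, of C T]) (use openT zT in auto)
  obtain z :: "nat \<Rightarrow> 'a" and n where zn: "Z = z ` {..<n}"
    using ex_bij_betw_nat_finite[OF Z(1)] by (metis atLeast0LessThan bij_betw_imp_surj_on)
  define L where "L l = C \<inter> T (z l) - (\<Union>j<l. T (z j))" for l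
  have Lm [measurable]: "L l \<in> sets borel" for l
    unfolding L_def using Tm by (intro sets.Diff sets.Int sets.finite_UN) auto
  have disj: "disjoint_family_on L {..<n}"
    unfolding disjoint_family_on_def L_def by (auto simp: neq_iff)
  show ?thesis
  proof (rule that[of U "\<lambda>l. emeasure \<nu> (L l)" n z, OF U(1,2)])
    have "(\<Sum>l<n. emeasure \<nu> (L l)) = emeasure \<nu> (\<Union>l<n. L l)"
      using disj Lm by (intro sum_emeasure) auto
    also have "\<dots> \<le> emeasure \<nu> UNIV"
      by (intro emeasure_mono) auto
    finally show "(\<Sum>l<n. emeasure \<nu> (L l)) \<le> emeasure \<nu> UNIV" .
  next
    fix x assume "x \<in> K"
    then obtain x0 where x0X: "x0 \<in> X" "x \<in> W x0"
      using X(3) by blast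
    then have x0: "x0 \<in> X" "x \<in> W x0" "x0 \<in> K"
      using X(1) by auto
    define m where "m l = (INF u\<in>U. k (\<iota> x0) (- (z l + u) + x))" for l
    have le: "s x0 y \<le> (\<Sum>l<n. m l * indicator (L l) y)" for y
    proof (cases "s x0 y = 0")
      case False
      then have "y \<in> C"
        using x0 by (auto simp: C_def)
      then have ex: "\<exists>l. l < n \<and> y \<in> T (z l)"
        using Z zn by auto
      define l where "l = (LEAST l. l < n \<and> y \<in> T (z l))"
      have l: "l < n" "y \<in> T (z l)"
        using LeastI_ex[OF ex] by (auto simp: l_def)
      have "y \<notin> T (z j)" if "j < l" for j
        using not_less_Least[of j "\<lambda>l. l < n \<and> y \<in> T (z l)"] that l(1) by (auto simp: l_def)
      then have yL: "y \<in> L l"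
        using l \<open>y \<in> C\<close> by (auto simp: L_def)
      have "s x0 y \<le> m l"
        unfolding m_def
      proof (rule INF_greatest)
        fix u assume u: "u \<in> U"
        \<comment> \<open>Write \<open>z l + u = y + v\<close> with \<open>v = - (- z l + y) + u \<in> - U + U\<close>.\<close>
        have "- (- z l + y) + u \<in> V x0"
          using UV[of "- z l + y" u] l(2) u x0(1) by (auto simp: T_def V0_def)
        then have "s x0 y < k (\<iota> x0) (- (y + (- (- z l + y) + u)) + x)"
          using sel[OF x0(3)] False x0(2) by blast
        also have "y + (- (- z l + y) + u) = z l + u"
          by (simp add: minus_add add.assoc[symmetric])
        finally show "s x0 y \<le> k (\<iota> x0) (- (z l + u) + x)"
          by simp
      qed
      also have "\<dots> = m l * indicator (L l) y"
        using yL by simp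
      also have "\<dots> \<le> (\<Sum>l<n. m l * indicator (L l) y)"
        using l(1) by (intro member_le_sum) auto
      finally show ?thesis .
    qed simp
    have "\<alpha> < (\<integral>\<^sup>+y. s x0 y \<partial>\<nu>)"
      using sel[OF x0(3)] by blast
    also have "\<dots> \<le> (\<integral>\<^sup>+y. (\<Sum>l<n. m l * indicator (L l) y) \<partial>\<nu>)"
      by (intro nn_integral_mono le)
    also have "\<dots> = (\<Sum>l<n. \<integral>\<^sup>+y. m l * indicator (L l) y \<partial>\<nu>)"
      by (intro nn_integral_sum) measurable
    also have "\<dots> = (\<Sum>l<n. emeasure \<nu> (L l) * m l)"
      by (simp add: nn_integral_cmult_indicator mult.commute)
    finally show "\<exists>i\<in>I. \<alpha> < (\<Sum>l<n. emeasure \<nu> (L l) * (INF u\<in>U. k i (- (z l + u) + x)))"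
      unfolding m_def by (rule bexI) (rule conjunct1[OF sel[OF x0(3)]])
  qed
qed

section \<open>Haar measure\<close>

lemma left_haar_inner_regular: "left_haar_measure lam \<Longrightarrow> inner_regular lam"
  by (simp add: left_haar_measure_def inner_regular_def)

lemma left_haar_translate:
  assumes "left_haar_measure lam" "A \<in> sets borel"
  shows "emeasure lam ((\<lambda>x. z + x) -` A) = emeasure lam A"
proof -
  have "(\<lambda>x. z + x) -` A = (+) (- z) ` A"
  proof (intro set_eqI iffI)
    fix x assume "x \<in> (\<lambda>x. z + x) -` A"
    then show "x \<in> (+) (- z) ` A"
      by (intro image_eqI[of _ _ "z + x"]) (auto simp: add.assoc[symmetric])
  qed (auto simp: add.assoc[symmetric])
  then show ?thesis
    using assms by (simp add: left_haar_measure_def)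
qed

lemma left_haar_nn_integral_translate:
  assumes lam: "left_haar_measure lam" and f: "f \<in> borel_measurable borel"
  shows "(\<integral>\<^sup>+x. f (z + x) \<partial>lam) = (\<integral>\<^sup>+x. f x \<partial>lam)"
proof -
  have s: "sets lam = sets borel" and sp: "space lam = UNIV"
    using inner_regular_sets inner_regular_space left_haar_inner_regular[OF lam] by blast+
  have m: "(\<lambda>x. z + x) \<in> lam \<rightarrow>\<^sub>M lam"
    by (subst measurable_cong_sets[OF s s]) measurable
  have "distr lam lam (\<lambda>x. z + x) = lam"
    using left_haar_translate[OF lam] s
    by (intro measure_eqI) (auto simp: emeasure_distr[OF m] sp)
  then have "(\<integral>\<^sup>+x. f x \<partial>lam) = (\<integral>\<^sup>+x. f x \<partial>distr lam lam (\<lambda>x. z + x))"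
    by simp
  also have "\<dots> = (\<integral>\<^sup>+x. f (z + x) \<partial>lam)"
    using f by (intro nn_integral_distr m) (simp add: measurable_cong_sets[OF s refl])
  finally show ?thesis ..
qed

text \<open>
  Finitely many translates of \<open>U\<close> cover a given compact set. If \<open>U\<close> were null, all compact sets would be
  null, and so would the whole group by inner regularity.
\<close>

lemma left_haar_open_pos:
  fixes lam :: "'a::{topological_group_add, t2_space} measure"
  assumes lam: "left_haar_measure lam" and U: "open U" "0 \<in> U"
  shows "0 < emeasure lam U"
proof (rule ccontr)
  assume "\<not> 0 < emeasure lam U"
  then have U0: "emeasure lam U = 0"
    by simp
  have s: "sets lam = sets borel"
    using lam by (simp add: left_haar_measure_def)
  define T where "T z = (\<lambda>y. - z + y) -` U" for z
  have T: "open (T z)" "z \<in> T z" "T z \<in> null_sets lam" for z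
  proof -
    show o: "open (T z)"
      unfolding T_def by (rule open_vimage[OF U(1) continuous_on_inverse_translate(2)])
    show "z \<in> T z"
      using U(2) by (simp add: T_def)
    show "T z \<in> null_sets lam"
      using o left_haar_translate[OF lam, of U "- z"] U U0 s by (simp add: T_def null_sets_def)
  qed
  have "emeasure lam K = 0" if K: "compact K" for K
  proof -
    obtain Z where Z: "Z \<subseteq> K" "finite Z" "K \<subseteq> (\<Union>z\<in>Z. T z)"
      by (rule compactE_image[OF K, of K T]) (use T in auto)
    have "(\<Union>z\<in>Z. T z) \<in> null_sets lam"
      using Z(2) T(3) by (intro null_sets.finite_UN) auto
    then show ?thesis
      using Z(3) K compact_in_borel s by (auto intro: emeasure_eq_0[of "\<Union>z\<in>Z. T z"] simp: null_sets_def)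
  qed
  then have "(SUP K\<in>{K. compact K \<and> K \<subseteq> UNIV}. emeasure lam K) \<le> 0"
    by (intro SUP_least) simp
  moreover have "emeasure lam UNIV = (SUP K\<in>{K. compact K \<and> K \<subseteq> UNIV}. emeasure lam K)"
    using lam by (auto simp: left_haar_measure_def)
  ultimately show False
    using lam by (simp add: left_haar_measure_def)
qed

text \<open>
  A weak form of \<open>\<parallel>\<nu> * h\<parallel>\<^sub>1 \<le> \<nu>(X) \<parallel>h\<parallel>\<^sub>1\<close>: on a compact
  subset of the level set \<open>\<nu>\<close> may be replaced by finitely many point masses, for which the inequality is
  translation invariance.
\<close>

lemma lsc_convolution_weak_type:
  fixes lam :: "'a::{topological_group_add, t2_space} measure"
  assumes lam: "left_haar_measure lam" and \<nu>: "inner_regular \<nu>" and fin: "emeasure \<nu> UNIV < \<infinity>" and h: "lsc h"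
  shows "\<delta> * emeasure lam {x. \<delta> < (\<integral>\<^sup>+y. h (- y + x) \<partial>\<nu>)} \<le> emeasure \<nu> UNIV * (\<integral>\<^sup>+x. h x \<partial>lam)"
proof -
  have s: "sets lam = sets borel"
    using lam by (simp add: left_haar_measure_def)
  note [measurable_cong] = s
  note [measurable] = lsc_borel_measurable[OF h]
  let ?E = "{x. \<delta> < (\<integral>\<^sup>+y. h (- y + x) \<partial>\<nu>)}"
  have "open ?E"
    using lsc_convolution[OF \<nu> fin h] by (simp add: lsc_def)
  then have "emeasure lam ?E = (SUP K\<in>{K. compact K \<and> K \<subseteq> ?E}. emeasure lam K)"
    using lam borel_open by (auto simp: left_haar_measure_def)
  moreover have "\<delta> * emeasure lam K \<le> emeasure \<nu> UNIV * (\<integral>\<^sup>+x. h x \<partial>lam)"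
    if K: "compact K" "K \<subseteq> ?E" for K
  proof -
    obtain U n and z :: "nat \<Rightarrow> 'a" and c :: "nat \<Rightarrow> ennreal"
      where Unzc: "open U" "0 \<in> U" "(\<Sum>l<n. c l) \<le> emeasure \<nu> UNIV"
        "\<And>x. x \<in> K \<Longrightarrow> \<exists>i\<in>(UNIV :: unit set). \<delta> < (\<Sum>l<n. c l * (INF u\<in>U. h (- (z l + u) + x)))"
      by (rule convolution_discretization[OF \<nu> fin _ K(1), of "UNIV :: unit set" "\<lambda>_. h" \<delta>]) (use h K(2) in auto)
    have [measurable]: "K \<in> sets borel"
      using K(1) by (rule compact_in_borel)
    have "\<delta> * emeasure lam K = (\<integral>\<^sup>+x. \<delta> * indicator K x \<partial>lam)"
      by (simp add: nn_integral_cmult_indicator s)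
    also have "\<dots> \<le> (\<integral>\<^sup>+x. (\<Sum>l<n. c l * h (- z l + x)) \<partial>lam)"
    proof (intro nn_integral_mono)
      fix x
      show "\<delta> * indicator K x \<le> (\<Sum>l<n. c l * h (- z l + x))"
      proof (cases "x \<in> K")
        case True
        then have "\<delta> < (\<Sum>l<n. c l * (INF u\<in>U. h (- (z l + u) + x)))"
          using Unzc(4) by auto
        also have "\<dots> \<le> (\<Sum>l<n. c l * h (- (z l + 0) + x))"
          using Unzc(2) by (intro sum_mono mult_left_mono INF_lower) auto
        finally show ?thesis
          using True by simp
      qed simp
    qed
    also have "\<dots> = (\<Sum>l<n. c l * (\<integral>\<^sup>+x. h (- z l + x) \<partial>lam))"
      by (simp add: nn_integral_sum nn_integral_cmult)
    also have "\<dots> = (\<Sum>l<n. c l) * (\<integral>\<^sup>+x. h x \<partial>lam)"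
      using left_haar_nn_integral_translate[OF lam, of h] by (simp add: sum_distrib_right)
    also have "\<dots> \<le> emeasure \<nu> UNIV * (\<integral>\<^sup>+x. h x \<partial>lam)"
      using Unzc(3) by (rule mult_right_mono) simp
    finally show ?thesis .
  qed
  ultimately show ?thesis
    by (auto simp: SUP_mult_left_ennreal intro!: SUP_least)
qed

text \<open>
  The link between measures and functions: spreading each point mass \<open>c l\<close> evenly over \<open>z l + N\<close>, for a
  compact \<open>N \<subseteq> U\<close> of positive measure, turns the discretization of \<open>\<nu>\<close> into an integrable
  function of no larger norm.
\<close>

lemma convolution_step_function:
  fixes lam :: "'a::{topological_group_add, t2_space} measure" and k :: "'i \<Rightarrow> 'a \<Rightarrow> ennreal"
  assumes lam: "left_haar_measure lam"
    and \<nu>: "inner_regular \<nu>" and fin: "emeasure \<nu> UNIV < \<infinity>" and k: "\<And>i. i \<in> I \<Longrightarrow> lsc (k i)"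
    and K: "compact K" and large: "\<And>x. x \<in> K \<Longrightarrow> \<exists>i\<in>I. \<alpha> < (\<integral>\<^sup>+y. k i (- y + x) \<partial>\<nu>)"
  obtains f :: "'a \<Rightarrow> real"
  where "\<And>y. 0 \<le> f y" "integrable lam f" "ennreal (\<integral>y. f y \<partial>lam) \<le> emeasure \<nu> UNIV"
    "\<And>x. x \<in> K \<Longrightarrow> \<exists>i\<in>I. \<alpha> < (\<integral>\<^sup>+y. k i (- y + x) * ennreal (f y) \<partial>lam)"
proof -
  have s: "sets lam = sets borel"
    using lam by (simp add: left_haar_measure_def)
  note [measurable_cong] = s
  obtain U and n :: nat and z :: "nat \<Rightarrow> 'a" and c :: "nat \<Rightarrow> ennreal"
    where Unzc: "open U" "0 \<in> U" "(\<Sum>l<n. c l) \<le> emeasure \<nu> UNIV"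
      "\<And>x. x \<in> K \<Longrightarrow> \<exists>i\<in>I. \<alpha> < (\<Sum>l<n. c l * (INF u\<in>U. k i (- (z l + u) + x)))"
    by (rule convolution_discretization[OF \<nu> fin _ K, of I k \<alpha>]) (rule k large that; assumption)+
  have "0 < (SUP K\<in>{K. compact K \<and> K \<subseteq> U}. emeasure lam K)"
    using left_haar_open_pos[OF lam Unzc(1,2)] lam borel_open[OF Unzc(1)]
    by (simp add: left_haar_measure_def)
  then obtain N where N: "compact N" "N \<subseteq> U" "0 < emeasure lam N"
    by (auto simp: less_SUP_iff)
  have Nfin: "emeasure lam N < \<infinity>"
    using lam N(1) by (simp add: left_haar_measure_def)
  have [measurable]: "N \<in> sets borel"
    using N(1) by (rule compact_in_borel)
  have scale: "b / emeasure lam N * emeasure lam N = b" for b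
    using N(3) Nfin by (simp add: ennreal_divide_times ennreal_divide_self)
  define g where "g y = (\<Sum>l<n. c l / emeasure lam N * indicator N (- z l + y))" for y
  have [measurable]: "g \<in> borel_measurable borel"
    unfolding g_def by measurable
  have cfin: "c l < \<infinity>" if "l < n" for l
    using member_le_sum[of l "{..<n}" c] that Unzc(3) fin by (auto intro: le_less_trans)
  have cdiv: "c l / emeasure lam N < top" if "l < n" for l
    using cfin[OF that] N(3) unfolding less_top[symmetric] ennreal_divide_eq_top_iff by auto
  have gfin: "g y < \<infinity>" for y
    using cdiv by (auto simp: g_def ennreal_divide_eq_top_iff less_top ennreal_mult_eq_top_iff split: split_indicator)
  have conv: "(\<integral>\<^sup>+y. q y * g y \<partial>lam) = (\<Sum>l<n. c l / emeasure lam N * (\<integral>\<^sup>+u. q (z l + u) * indicator N u \<partial>lam))"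
    if [measurable]: "q \<in> borel_measurable borel" for q
  proof -
    have "(\<integral>\<^sup>+y. q y * g y \<partial>lam) = (\<integral>\<^sup>+y. (\<Sum>l<n. c l / emeasure lam N * (q y * indicator N (- z l + y))) \<partial>lam)"
      unfolding g_def sum_distrib_left by (intro nn_integral_cong sum.cong refl mult.left_commute)
    also have "\<dots> = (\<Sum>l<n. c l / emeasure lam N * (\<integral>\<^sup>+y. q y * indicator N (- z l + y) \<partial>lam))"
      by (simp add: nn_integral_sum nn_integral_cmult)
    also have "\<dots> = (\<Sum>l<n. c l / emeasure lam N * (\<integral>\<^sup>+u. q (z l + u) * indicator N u \<partial>lam))"
    proof (intro sum.cong refl arg_cong2[where f = "(*)"])
      fix l
      show "(\<integral>\<^sup>+y. q y * indicator N (- z l + y) \<partial>lam) = (\<integral>\<^sup>+u. q (z l + u) * indicator N u \<partial>lam)"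
        by (subst left_haar_nn_integral_translate[OF lam, of _ "z l", symmetric]) (auto simp: add.assoc[symmetric])
    qed
    finally show ?thesis .
  qed
  have intg: "(\<integral>\<^sup>+y. g y \<partial>lam) \<le> emeasure \<nu> UNIV"
    using conv[of "\<lambda>_. 1"] Unzc(3) by (simp add: scale s)
  define f where "f y = enn2real (g y)" for y
  have fg: "ennreal (f y) = g y" for y
    using gfin by (simp add: f_def)
  have [measurable]: "f \<in> borel_measurable borel"
    unfolding f_def by measurable
  have f0: "0 \<le> f y" for y
    by (simp add: f_def)
  have intf: "integrable lam f"
    using intg fin f0 by (intro integrableI_nonneg) (auto simp: fg intro: le_less_trans)
  show ?thesis
  proof (rule that[OF f0 intf])
    show "ennreal (\<integral>y. f y \<partial>lam) \<le> emeasure \<nu> UNIV"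
      using intg nn_integral_eq_integral[OF intf] f0 by (simp add: fg)
    fix x assume "x \<in> K"
    then obtain i where i: "i \<in> I" "\<alpha> < (\<Sum>l<n. c l * (INF u\<in>U. k i (- (z l + u) + x)))"
      using Unzc(4) by auto
    note [measurable] = lsc_borel_measurable[OF k[OF i(1)]]
    note i(2)
    also have "(\<Sum>l<n. c l * (INF u\<in>U. k i (- (z l + u) + x))) \<le>
        (\<Sum>l<n. c l / emeasure lam N * (\<integral>\<^sup>+u. k i (- (z l + u) + x) * indicator N u \<partial>lam))"
    proof (intro sum_mono)
      fix l
      have "c l * (INF u\<in>U. k i (- (z l + u) + x)) =
          c l / emeasure lam N * (\<integral>\<^sup>+u. (INF u\<in>U. k i (- (z l + u) + x)) * indicator N u \<partial>lam)"
        by (subst (1) scale[of "c l", symmetric], subst nn_integral_cmult_indicator) (simp_all add: s mult_ac)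
      also have "\<dots> \<le> c l / emeasure lam N * (\<integral>\<^sup>+u. k i (- (z l + u) + x) * indicator N u \<partial>lam)"
        using N(2) by (intro mult_left_mono nn_integral_mono) (auto intro: INF_lower split: split_indicator)
      finally show "c l * (INF u\<in>U. k i (- (z l + u) + x)) \<le>
          c l / emeasure lam N * (\<integral>\<^sup>+u. k i (- (z l + u) + x) * indicator N u \<partial>lam)" .
    qed
    also have "\<dots> = (\<integral>\<^sup>+y. k i (- y + x) * g y \<partial>lam)"
      by (rule conv[symmetric]) measurable
    finally show "\<exists>i\<in>I. \<alpha> < (\<integral>\<^sup>+y. k i (- y + x) * ennreal (f y) \<partial>lam)"
      unfolding fg using i(1) by auto
  qed
qed

section \<open>Borel kernels\<close>

text \<open>
  For kernels that are indicators of open sets the convolution is lower semicontinuous. The class of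
  good kernels is extended by Dynkin's theorem, which needs \<open>\<nu>\<close> to be finite for complements, and then by the
  usual approximation with simple functions.
\<close>

lemma convolution_measurable:
  fixes \<nu> :: "'a::{topological_group_add, t2_space} measure"
  assumes \<nu>: "inner_regular \<nu>" and fin: "emeasure \<nu> UNIV < \<infinity>" and k: "k \<in> borel_measurable borel"
  shows "(\<lambda>x. \<integral>\<^sup>+y. k (- y + x) \<partial>\<nu>) \<in> borel_measurable borel"
proof -
  note [measurable_cong] = inner_regular_sets[OF \<nu>]
  note [simp] = inner_regular_space[OF \<nu>]
  have set: "(\<lambda>x. \<integral>\<^sup>+y. indicator A (- y + x) \<partial>\<nu>) \<in> borel_measurable borel"
    if "A \<in> sets borel" for A :: "'a set"
  proof -
    have "Int_stable {S :: 'a set. open S}" "{S :: 'a set. open S} \<subseteq> Pow UNIV"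
        "A \<in> sigma_sets UNIV {S. open S}"
      using that by (auto simp: Int_stable_def borel_def)
    then show ?thesis
    proof (induction rule: sigma_sets_induct_disjoint)
      case (basic A)
      then have "lsc (indicator A :: 'a \<Rightarrow> ennreal)"
        using lsc_const_indicator[of A 1] by simp
      then show ?case
        by (intro lsc_borel_measurable lsc_convolution \<nu> fin)
    next
      case (compl A)
      then have [measurable]: "A \<in> sets borel"
        by (simp add: borel_def)
      have "(\<integral>\<^sup>+y. indicator (UNIV - A) (- y + x) \<partial>\<nu>) = emeasure \<nu> UNIV - (\<integral>\<^sup>+y. indicator A (- y + x) \<partial>\<nu>)" for x
      proof -
        have "(\<integral>\<^sup>+y. indicator (UNIV - A) (- y + x) \<partial>\<nu>) = (\<integral>\<^sup>+y. 1 - indicator A (- y + x) \<partial>\<nu>)"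
          by (intro nn_integral_cong) (simp split: split_indicator)
        also have "\<dots> = (\<integral>\<^sup>+y. 1 \<partial>\<nu>) - (\<integral>\<^sup>+y. indicator A (- y + x) \<partial>\<nu>)"
        proof (rule nn_integral_diff)
          have "(\<integral>\<^sup>+y. indicator A (- y + x) \<partial>\<nu>) \<le> (\<integral>\<^sup>+y. 1 \<partial>\<nu>)"
            by (intro nn_integral_mono) (simp split: split_indicator)
          also have "\<dots> < \<infinity>"
            using fin by simp
          finally show "(\<integral>\<^sup>+y. indicator A (- y + x) \<partial>\<nu>) \<noteq> \<infinity>"
            by simp
        qed (auto split: split_indicator)
        finally show ?thesis by simp
      qed
      with compl show ?case by simp
    next
      case (union F)
      have [measurable]: "F i \<in> sets borel" for i
        using union(2) by (auto simp: borel_def)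
      have "(\<integral>\<^sup>+y. indicator (\<Union>i. F i) (- y + x) \<partial>\<nu>) = (\<Sum>i. \<integral>\<^sup>+y. indicator (F i) (- y + x) \<partial>\<nu>)" for x
        using suminf_indicator[OF union(1)] by (subst nn_integral_suminf[symmetric]) auto
      then show ?case
        using union(3) by simp
    qed simp
  qed
  show ?thesis
    using k
  proof (induction rule: borel_measurable_induct)
    case (cong f g)
    then show ?case by simp
  next
    case (set A)
    then show ?case by (rule \<open>\<And>A. A \<in> sets borel \<Longrightarrow> _\<close>)
  next
    case (mult u c)
    note [measurable] = mult(2,4)
    show ?case by (simp add: nn_integral_cmult)
  next
    case (add u v)
    note [measurable] = add
    show ?case by (simp add: nn_integral_add)
  next
    case (seq U)
    note [measurable] = seq(1,5)
    have "(\<integral>\<^sup>+y. (SUP i. U i) (- y + x) \<partial>\<nu>) = (SUP i. \<integral>\<^sup>+y. U i (- y + x) \<partial>\<nu>)" for x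
      using seq(3) by (subst nn_integral_monotone_convergence_SUP[symmetric])
        (auto simp: incseq_def le_fun_def image_comp)
    then show ?case by simp
  qed
qed

lemma inner_regular_approx:
  fixes M :: "'a::t2_space measure"
  assumes M: "inner_regular M" and A: "A \<in> sets borel" and fin: "emeasure M A < \<infinity>" and e: "0 < e"
  obtains C where "compact C" "C \<subseteq> A" "emeasure M (A - C) < e"
proof -
  obtain C :: "nat \<Rightarrow> 'a set" where C: "\<And>n. compact (C n)" "\<And>n. C n \<subseteq> A" "incseq C"
      "emeasure M (A - (\<Union>n. C n)) = 0"
    using inner_regular_exhaustion[OF M A fin] by blast
  have m: "A - C n \<in> sets M" for n
    using compact_in_borel[OF C(1)] A by (auto simp: inner_regular_sets[OF M])
  have f: "emeasure M (A - C n) \<noteq> \<infinity>" for n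
    using emeasure_mono[of "A - C n" A M] fin A by (auto simp: inner_regular_sets[OF M] top_unique)
  have "decseq (\<lambda>n. A - C n)"
    using C(3) by (auto simp: incseq_def decseq_def)
  then have "(\<lambda>n. emeasure M (A - C n)) \<longlonglongrightarrow> emeasure M (\<Inter>n. A - C n)"
    using m f by (intro Lim_emeasure_decseq) auto
  also have "(\<Inter>n. A - C n) = A - (\<Union>n. C n)"
    by auto
  finally have "eventually (\<lambda>n. emeasure M (A - C n) < e) sequentially"
    using C(4) e by (intro order_tendstoD(2)) auto
  then obtain n where "emeasure M (A - C n) < e"
    by (auto simp: eventually_sequentially)
  with C show ?thesis
    using that by blast
qed

text \<open>
  Outer regularity, with the error \<open>G - A\<close> enclosed in an open set. Local compactness provides an open
  \<open>V \<supseteq> Q\<close> of finite measure. Inner regularity then gives compact sets \<open>C \<subseteq> A\<close> and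
  \<open>C' \<subseteq> V - A\<close> that miss little, and one takes \<open>G = V - C'\<close> and \<open>D = G - C\<close>.
\<close>

lemma outer_approx_in_compact:
  fixes M :: "'a::t2_space measure"
  assumes lc: "locally_compact_space (euclidean :: 'a topology)"
    and M: "inner_regular M" and Mfin: "\<And>K. compact K \<Longrightarrow> emeasure M K < \<infinity>"
    and A: "A \<in> sets borel" "A \<subseteq> Q" and Q: "compact Q" and e: "0 < (e::ennreal)"
  obtains G D where "open G" "open D" "A \<subseteq> G" "G \<subseteq> A \<union> D" "emeasure M D \<le> e"
proof -
  note [simp] = inner_regular_sets[OF M]
  have "\<forall>x::'a. \<exists>U. open U \<and> (\<exists>K. compact K \<and> x \<in> U \<and> U \<subseteq> K)"
    using lc by (simp add: locally_compact_space_def)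
  then obtain W N where WN: "\<And>x::'a. open (W x)" "\<And>x. compact (N x)" "\<And>x. x \<in> W x" "\<And>x. W x \<subseteq> N x"
    by metis
  obtain X where X: "X \<subseteq> Q" "finite X" "Q \<subseteq> (\<Union>x\<in>X. W x)"
    by (rule compactE_image[OF Q, of Q W]) (use WN in auto)
  define V where "V = (\<Union>x\<in>X. W x)"
  have V: "open V" "Q \<subseteq> V"
    using X WN by (auto simp: V_def)
  have "compact (\<Union>x\<in>X. N x)"
    using X WN by (intro compact_UN) auto
  then have Vfin: "emeasure M B < \<infinity>" if "B \<subseteq> V" "B \<in> sets borel" for B
    using that WN(4) compact_in_borel
    by (intro le_less_trans[OF emeasure_mono Mfin[of "\<Union>x\<in>X. N x"]]) (fastforce simp: V_def)+
  have Vm: "V \<in> sets borel"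
    using V by simp
  have e2: "0 < e / 2"
    using e by (simp add: ennreal_zero_less_divide)
  obtain C where C: "compact C" "C \<subseteq> A" "emeasure M (A - C) < e / 2"
    using inner_regular_approx[OF M A(1) Vfin e2] A V by auto
  have VA: "V - A \<in> sets borel" "V - A \<subseteq> V"
    using Vm A by auto
  obtain C' where C': "compact C'" "C' \<subseteq> V - A" "emeasure M (V - A - C') < e / 2"
    using inner_regular_approx[OF M VA(1) Vfin[OF VA(2,1)] e2] by auto
  show ?thesis
  proof (rule that[of "V - C'" "V - C' - C"])
    show "open (V - C')" "open (V - C' - C)"
      using V(1) C(1) C'(1) by (auto intro!: open_Diff compact_imp_closed)
    show "A \<subseteq> V - C'" "V - C' \<subseteq> A \<union> (V - C' - C)"
      using A V C C' by auto
    have "emeasure M (V - C' - C) \<le> emeasure M ((A - C) \<union> (V - A - C'))"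
      using A Vm compact_in_borel[OF C(1)] compact_in_borel[OF C'(1)] by (intro emeasure_mono) auto
    also have "\<dots> \<le> emeasure M (A - C) + emeasure M (V - A - C')"
      using A Vm compact_in_borel[OF C(1)] compact_in_borel[OF C'(1)] by (intro emeasure_subadditive) auto
    also have "\<dots> \<le> e / 2 + e / 2"
      using C C' by (intro add_mono) auto
    also have "\<dots> = e"
      using ennreal_divide_times[of e 2 2] ennreal_divide_self[of 2] by (simp add: mult_2_right[symmetric])
    finally show "emeasure M (V - C' - C) \<le> e" .
  qed
qed

lemma summable_tolerances:
  fixes \<epsilon> :: real
  assumes "0 < \<epsilon>"
  obtains e :: "nat \<Rightarrow> real" where "\<And>n. 0 < e n" "(\<Sum>n. ennreal (e n)) = ennreal \<epsilon>"
proof (rule that[of "\<lambda>n. \<epsilon> * (1 / 2) ^ Suc n"])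
  show "(\<Sum>n. ennreal (\<epsilon> * (1 / 2) ^ Suc n)) = ennreal \<epsilon>"
    using sums_mult[OF power_half_series, of \<epsilon>] assms by (intro suminf_ennreal_eq) auto
qed (use assms in simp)

text \<open>
  Containment in a \<open>\<sigma>\<close>-compact set matters: a null set in an inner regular measure may have only
  open neighbourhoods of infinite measure. An example is \<open>X \<times> {0}\<close> in \<open>X \<times> \<real>\<close>, where \<open>X\<close>
  denotes the real line with the discrete topology.
\<close>

lemma outer_approx_in_sigma_compact:
  fixes M :: "'a::t2_space measure"
  assumes lc: "locally_compact_space (euclidean :: 'a topology)"
    and M: "inner_regular M" and Mfin: "\<And>K. compact K \<Longrightarrow> emeasure M K < \<infinity>"
    and A: "A \<in> sets borel" "A \<subseteq> (\<Union>n::nat. Q n)" and Q: "\<And>n. compact (Q n)" and e: "0 < e"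
  obtains G D where "open G" "open D" "A \<subseteq> G" "G \<subseteq> A \<union> D" "emeasure M D \<le> ennreal e"
proof -
  obtain d :: "nat \<Rightarrow> real" where d: "\<And>n. 0 < d n" "(\<Sum>n. ennreal (d n)) = ennreal e"
    using summable_tolerances[OF e] by blast
  have "\<exists>G D. open G \<and> open D \<and> A \<inter> Q n \<subseteq> G \<and> G \<subseteq> (A \<inter> Q n) \<union> D \<and> emeasure M D \<le> ennreal (d n)" for n
  proof -
    have "A \<inter> Q n \<in> sets borel"
      using A(1) compact_in_borel[OF Q] by auto
    moreover have "0 < ennreal (d n)"
      using d(1)[of n] by simp
    ultimately show ?thesis
      using outer_approx_in_compact[OF lc M Mfin _ Int_lower2 Q] by metis
  qed
  then obtain G D where GD: "\<And>n. open (G n)" "\<And>n. open (D n)" "\<And>n. A \<inter> Q n \<subseteq> G n"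
      "\<And>n. G n \<subseteq> (A \<inter> Q n) \<union> D n" "\<And>n. emeasure M (D n) \<le> ennreal (d n)"
    by metis
  show ?thesis
  proof (rule that[of "\<Union>n. G n" "\<Union>n. D n"])
    show "A \<subseteq> (\<Union>n. G n)"
    proof
      fix x assume "x \<in> A"
      moreover from this obtain n where "x \<in> Q n" using A(2) by auto
      ultimately show "x \<in> (\<Union>n. G n)" using GD(3)[of n] by auto
    qed
    show "(\<Union>n. G n) \<subseteq> A \<union> (\<Union>n. D n)"
    proof
      fix x assume "x \<in> (\<Union>n. G n)"
      then obtain n where "x \<in> G n" by auto
      then show "x \<in> A \<union> (\<Union>n. D n)" using GD(4)[of n] by auto
    qed
    have "emeasure M (\<Union>n. D n) \<le> (\<Sum>n. emeasure M (D n))"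
      using GD(2) by (intro emeasure_subadditive_countably) (auto simp: inner_regular_sets[OF M])
    also have "\<dots> \<le> (\<Sum>n. ennreal (d n))"
      by (intro suminf_le GD(5) summableI)
    finally show "emeasure M (\<Union>n. D n) \<le> ennreal e"
      by (simp add: d(2))
  qed (use GD in auto)
qed

text \<open>
  The function \<open>k\<close> is the supremum of \<open>q \<cdot> 1\<^bsub>{k > q}\<^esub>\<close> over the rational numbers \<open>q \<ge> 0\<close>.
  Each set \<open>{k > q}\<close> is enlarged to an open set, and the excess lies in a small open set \<open>D\<close>. The
  suprema of the resulting functions are lower semicontinuous. The excess \<open>h\<close> is lower semicontinuous as well,
  so that the weak type estimate for lower semicontinuous kernels applies to it.
\<close>

lemma lsc_majorant:
  fixes M :: "'a::t2_space measure" and k :: "'a \<Rightarrow> ennreal"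
  assumes lc: "locally_compact_space (euclidean :: 'a topology)"
    and M: "inner_regular M" and Mfin: "\<And>K. compact K \<Longrightarrow> emeasure M K < \<infinity>"
    and k [measurable]: "k \<in> borel_measurable borel"
    and supp: "{x. 0 < k x} \<subseteq> (\<Union>n::nat. Q n)" and Q: "\<And>n. compact (Q n)" and e: "0 < e"
  obtains k' h where "lsc k'" "lsc h" "\<And>x. k x \<le> k' x" "\<And>x. k' x \<le> max (k x) (h x)"
    "(\<integral>\<^sup>+x. h x \<partial>M) \<le> ennreal e"
proof -
  note [measurable_cong] = inner_regular_sets[OF M]
  obtain d :: "nat \<Rightarrow> real" where d: "\<And>n. 0 < d n" "(\<Sum>n. ennreal (d n)) = ennreal e"
    using summable_tolerances[OF e] by blast
  define q where "q n = real_of_rat (nat_to_rat_surj n)" for n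
  have "\<exists>G D. open G \<and> open D \<and> {x. ennreal (q n) < k x} \<subseteq> G \<and> G \<subseteq> {x. ennreal (q n) < k x} \<union> D \<and>
      emeasure M D \<le> ennreal (d n / (\<bar>q n\<bar> + 1))" for n
  proof -
    have 1: "{x. ennreal (q n) < k x} \<in> sets borel"
      by measurable
    have 2: "{x. ennreal (q n) < k x} \<subseteq> (\<Union>n. Q n)"
      using supp by (auto intro: le_less_trans[OF zero_le])
    \<comment> \<open>The tolerance is divided by \<open>\<bar>q n\<bar> + 1\<close> to absorb the factor \<open>q n\<close> in \<open>h\<close>; negative \<open>q n\<close> become \<open>0\<close> in \<^typ>\<open>ennreal\<close>.\<close>
    have 3: "0 < d n / (\<bar>q n\<bar> + 1)"
      using d(1)[of n] by (intro divide_pos_pos) auto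
    show ?thesis
      using outer_approx_in_sigma_compact[OF lc M Mfin 1 2 Q 3] by metis
  qed
  then obtain G D where GD: "\<And>n. open (G n)" "\<And>n. open (D n)" "\<And>n. {x. ennreal (q n) < k x} \<subseteq> G n"
      "\<And>n. G n \<subseteq> {x. ennreal (q n) < k x} \<union> D n" "\<And>n. emeasure M (D n) \<le> ennreal (d n / (\<bar>q n\<bar> + 1))"
    by metis
  have [measurable]: "D n \<in> sets borel" for n
    using GD(2) by simp
  define k' where "k' x = (SUP n. ennreal (q n) * indicator (G n) x)" for x
  define h where "h x = (SUP n. ennreal (q n) * indicator (D n) x)" for x
  show ?thesis
  proof (rule that)
    show "lsc k'" "lsc h"
      unfolding k'_def h_def using GD(1,2) by (intro lsc_SUP lsc_const_indicator; simp)+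
    show "k x \<le> k' x" for x
    proof (rule ccontr)
      assume "\<not> k x \<le> k' x"
      then have "k' x < k x"
        by (simp add: not_le)
      then obtain r where r: "k' x < ennreal (real_of_rat r)" "ennreal (real_of_rat r) < k x"
        using ennreal_rat_dense by blast
      obtain n where "r = nat_to_rat_surj n"
        using surj_nat_to_rat_surj by (metis surjD)
      then have n: "ennreal (real_of_rat r) = ennreal (q n)"
        by (simp add: q_def)
      have "x \<in> G n"
        using r(2) GD(3)[of n] n by auto
      then have "ennreal (q n) \<le> k' x"
        unfolding k'_def by (intro SUP_upper2[of n]) auto
      then show False
        using r(1) n by simp
    qed
    show "k' x \<le> max (k x) (h x)" for x
      unfolding k'_def
    proof (rule SUP_least)
      fix n
      show "ennreal (q n) * indicator (G n) x \<le> max (k x) (h x)"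
      proof (cases "x \<in> D n")
        case True
        then have "ennreal (q n) \<le> h x"
          unfolding h_def by (intro SUP_upper2[of n]) auto
        then show ?thesis
          by (auto simp: le_max_iff_disj split: split_indicator)
      next
        case False
        then show ?thesis
          using GD(4)[of n] by (auto simp: le_max_iff_disj split: split_indicator)
      qed
    qed
    have term_le: "F n \<le> (\<Sum>n. F n)" for F :: "nat \<Rightarrow> ennreal" and n
      using sum_le_suminf[of F "{n}"] by (simp add: summableI)
    have "(\<integral>\<^sup>+x. h x \<partial>M) \<le> (\<integral>\<^sup>+x. (\<Sum>n. ennreal (q n) * indicator (D n) x) \<partial>M)"
    proof (intro nn_integral_mono)
      fix x
      show "h x \<le> (\<Sum>n. ennreal (q n) * indicator (D n) x)"
        unfolding h_def by (intro SUP_least term_le)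
    qed
    also have "\<dots> = (\<Sum>n. ennreal (q n) * emeasure M (D n))"
      by (simp add: nn_integral_suminf nn_integral_cmult_indicator inner_regular_sets[OF M])
    also have "\<dots> \<le> (\<Sum>n. ennreal (d n))"
    proof (intro suminf_le summableI)
      fix n
      have "ennreal (q n) * emeasure M (D n) \<le> ennreal (\<bar>q n\<bar>) * ennreal (d n / (\<bar>q n\<bar> + 1))"
        by (intro mult_mono GD(5) ennreal_leI) auto
      also have "\<dots> = ennreal (\<bar>q n\<bar> * (d n / (\<bar>q n\<bar> + 1)))"
        using d(1)[of n] by (intro ennreal_mult[symmetric]) auto
      also have "\<dots> \<le> ennreal (d n)"
        using d(1)[of n] by (intro ennreal_leI) (simp add: field_simps add_increasing2)
      finally show "ennreal (q n) * emeasure M (D n) \<le> ennreal (d n)" .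
    qed
    finally show "(\<integral>\<^sup>+x. h x \<partial>M) \<le> ennreal e"
      by (simp add: d(2))
  qed
qed

section \<open>Signed measures and measures with a density\<close>

text \<open>
  The set \<open>A \<inter> {g \<noteq> 0}\<close> is the union of the sets \<open>A \<inter> {g \<ge> 1 / (n + 1)}\<close>, which have finite measure because
  \<open>g\<close> is integrable. Each is exhausted by compact sets up to a null set, so their finite unions
  exhaust \<open>A\<close> for the measure with density \<open>g\<close>.
\<close>

lemma inner_regular_density:
  fixes M :: "'a::t2_space measure"
  assumes M: "inner_regular M" and g: "g \<in> borel_measurable borel" and fin: "(\<integral>\<^sup>+x. g x \<partial>M) < \<infinity>"
  shows "inner_regular (density M g)"
  unfolding inner_regular_def
proof (intro conjI ballI)
  note [measurable_cong] = inner_regular_sets[OF M]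
  note [measurable] = g
  show "sets (density M g) = sets borel"
    by (simp add: inner_regular_sets[OF M])
  fix A :: "'a set" assume A [measurable]: "A \<in> sets borel"
  define B where "B n = A \<inter> {x. ennreal (1 / real (Suc n)) \<le> g x}" for n
  have Bm [measurable]: "B n \<in> sets borel" for n
    unfolding B_def by measurable
  have Bfin: "emeasure M (B n) < \<infinity>" for n
  proof -
    have one: "ennreal (real (Suc n)) * ennreal (1 / real (Suc n)) = 1"
      by (simp del: of_nat_Suc flip: ennreal_mult)
    have "indicator (B n) x \<le> ennreal (real (Suc n)) * g x" for x
    proof (cases "x \<in> B n")
      case True
      then have "1 \<le> ennreal (real (Suc n)) * g x"
        unfolding one[symmetric] B_def by (intro mult_left_mono) auto
      with True show ?thesis by simp
    qed simp
    then have "(\<integral>\<^sup>+x. indicator (B n) x \<partial>M) \<le> (\<integral>\<^sup>+x. ennreal (real (Suc n)) * g x \<partial>M)"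
      by (intro nn_integral_mono)
    also have "\<dots> = ennreal (real (Suc n)) * (\<integral>\<^sup>+x. g x \<partial>M)"
      by (intro nn_integral_cmult) measurable
    also have "\<dots> < \<infinity>"
      using fin by (simp add: ennreal_mult_less_top del: of_nat_Suc)
    finally show ?thesis
      by (simp add: inner_regular_sets[OF M])
  qed
  have "\<exists>C :: nat \<Rightarrow> 'a set. (\<forall>m. compact (C m)) \<and> (\<forall>m. C m \<subseteq> B n) \<and> emeasure M (B n - (\<Union>m. C m)) = 0" for n
    using inner_regular_exhaustion[OF M Bm Bfin, of n] by metis
  then obtain C :: "nat \<Rightarrow> nat \<Rightarrow> 'a set" where C: "\<And>n m. compact (C n m)" "\<And>n m. C n m \<subseteq> B n"
      "\<And>n. emeasure M (B n - (\<Union>m. C n m)) = 0"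
    by metis
  define D where "D N = (\<Union>n\<le>N. \<Union>m\<le>N. C n m)" for N
  have Dc: "compact (D N)" for N
    unfolding D_def using C(1) by (intro compact_UN) auto
  have DA: "D N \<subseteq> A" for N
  proof
    fix x assume "x \<in> D N"
    then obtain n m where "x \<in> C n m" by (auto simp: D_def)
    then have "x \<in> B n" using C(2) by blast
    then show "x \<in> A" by (simp add: B_def)
  qed
  have Dm [measurable]: "D N \<in> sets borel" for N
    by (rule compact_in_borel[OF Dc])
  have Dinc: "incseq D"
    unfolding D_def incseq_def by (intro allI impI UN_mono) auto
  have CD: "C n m \<subseteq> (\<Union>N. D N)" for n m
  proof -
    have "C n m \<subseteq> D (max n m)"
      by (force simp: D_def)
    then show ?thesis by auto
  qed
  have "AE x in M. \<forall>n. x \<in> B n \<longrightarrow> x \<in> (\<Union>m. C n m)"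
  proof (intro AE_all_countable[THEN iffD2] allI)
    fix n
    have "(\<Union>m. C n m) \<in> sets borel"
      by (intro sets.countable_UN) (auto intro: compact_in_borel C(1))
    then show "AE x in M. x \<in> B n \<longrightarrow> x \<in> (\<Union>m. C n m)"
      using C(3)[of n] Bm[of n]
      by (intro AE_I[where N = "B n - (\<Union>m. C n m)"]) (auto simp: inner_regular_sets[OF M])
  qed
  then have "AE x in M. g x * indicator A x = g x * indicator (\<Union>N. D N) x"
  proof eventually_elim
    case (elim x)
    have "x \<in> (\<Union>N. D N)" if x: "x \<in> A" "g x \<noteq> 0"
    proof -
      obtain n where "ennreal (1 / real (Suc n)) \<le> g x"
      proof (cases "g x")
        case top
        then show ?thesis using that[of 0] by simp
      next
        case (real r)
        with x obtain n where "inverse (real (Suc n)) < r"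
          using reals_Archimedean[of r] by auto
        then show ?thesis
          using real that[of n] by (auto intro!: ennreal_leI simp: inverse_eq_divide)
      qed
      then have "x \<in> B n"
        using x(1) by (simp add: B_def)
      then obtain m where "x \<in> C n m"
        using elim by auto
      then show ?thesis
        using CD by blast
    qed
    then show ?case
      using DA by (cases "g x = 0") (auto split: split_indicator)
  qed
  then have "emeasure (density M g) A = emeasure (density M g) (\<Union>N. D N)"
    by (simp add: emeasure_density cong: nn_integral_cong_AE)
  also have "\<dots> = (SUP N. emeasure (density M g) (D N))"
    using Dinc by (intro SUP_emeasure_incseq[symmetric]) auto
  also have "\<dots> \<le> (SUP K\<in>{K. compact K \<and> K \<subseteq> A}. emeasure (density M g) K)"
    using Dc DA by (intro SUP_mono) auto
  finally show "emeasure (density M g) A = (SUP K\<in>{K. compact K \<and> K \<subseteq> A}. emeasure (density M g) K)"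
    by (intro antisym SUP_least emeasure_mono) auto
qed

definition plus_measure :: "'a measure \<Rightarrow> 'a measure \<Rightarrow> 'a measure" where
  "plus_measure M N = measure_of (space M) (sets M) (\<lambda>A. emeasure M A + emeasure N A)"

lemma sets_plus_measure [simp]: "sets (plus_measure M N) = sets M"
  by (simp add: plus_measure_def)

lemma space_plus_measure [simp]: "space (plus_measure M N) = space M"
  by (simp add: plus_measure_def)

lemma emeasure_plus_measure:
  assumes N: "sets N = sets M" and A: "A \<in> sets M"
  shows "emeasure (plus_measure M N) A = emeasure M A + emeasure N A"
  unfolding plus_measure_def
proof (rule emeasure_measure_of_sigma[OF sets.sigma_algebra_axioms _ _ A])
  show "positive (sets M) (\<lambda>A. emeasure M A + emeasure N A)"
    by (simp add: positive_def)
  show "countably_additive (sets M) (\<lambda>A. emeasure M A + emeasure N A)"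
  proof (rule countably_additiveI)
    fix F :: "nat \<Rightarrow> 'a set" assume "range F \<subseteq> sets M" "disjoint_family F"
    then show "(\<Sum>i. emeasure M (F i) + emeasure N (F i)) = emeasure M (\<Union>i. F i) + emeasure N (\<Union>i. F i)"
      using N by (simp add: suminf_add[symmetric] suminf_emeasure)
  qed
qed

lemma nn_integral_plus_measure:
  assumes N: "sets N = sets M" and f: "f \<in> borel_measurable M"
  shows "(\<integral>\<^sup>+x. f x \<partial>plus_measure M N) = (\<integral>\<^sup>+x. f x \<partial>M) + (\<integral>\<^sup>+x. f x \<partial>N)"
  using f
proof (induction rule: borel_measurable_induct)
  case (cong f g)
  then have "integral\<^sup>N N f = integral\<^sup>N N g"
    using sets_eq_imp_space_eq[OF N] by (intro nn_integral_cong) simp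
  moreover have "integral\<^sup>N M f = integral\<^sup>N M g" "integral\<^sup>N (plus_measure M N) f = integral\<^sup>N (plus_measure M N) g"
    using cong(3) by (auto intro!: nn_integral_cong)
  ultimately show ?case
    using cong(4) by simp
next
  case (set A)
  then show ?case
    using N by (simp add: emeasure_plus_measure)
next
  case (mult u c)
  then show ?case
    by (simp add: nn_integral_cmult distrib_left measurable_cong_sets[OF sets_plus_measure refl] measurable_cong_sets[OF N refl])
next
  case (add u v)
  then show ?case
    by (simp add: nn_integral_add measurable_cong_sets[OF sets_plus_measure refl] measurable_cong_sets[OF N refl] ac_simps)
next
  case (seq U)
  have m: "U i \<in> borel_measurable N" "U i \<in> borel_measurable (plus_measure M N)" for i
    using seq(1) by (simp_all add: measurable_cong_sets[OF sets_plus_measure refl] measurable_cong_sets[OF N refl])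
  have "(\<integral>\<^sup>+x. (SUP i. U i) x \<partial>L) = (SUP i. \<integral>\<^sup>+x. U i x \<partial>L)" if "\<And>i. U i \<in> borel_measurable L" for L
    using nn_integral_monotone_convergence_SUP[OF seq(3) that] by (simp add: image_comp)
  note conv = this[OF seq(1)] this[OF m(1)] this[OF m(2)]
  have mono: "incseq (\<lambda>i. \<integral>\<^sup>+x. U i x \<partial>L)" for L
    using seq(3) by (auto simp: incseq_def le_fun_def intro!: nn_integral_mono)
  show ?case
    unfolding seq(4) conv seq(5) by (rule ennreal_SUP_add[OF mono mono])
qed

lemma finite_real_borel_measure_uminus:
  "finite_real_borel_measure \<mu> \<Longrightarrow> finite_real_borel_measure (\<lambda>A. - \<mu> A)"
  by (auto simp: finite_real_borel_measure_def intro: sums_minus)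

lemma finite_real_borel_measure_Un:
  assumes \<mu>: "finite_real_borel_measure \<mu>" and "B \<in> sets borel" "C \<in> sets borel" "B \<inter> C = {}"
  shows "\<mu> (B \<union> C) = \<mu> B + \<mu> C"
proof -
  have "range (binaryset B C) \<subseteq> sets borel" "disjoint_family (binaryset B C)"
    using assms(2-4) by (auto simp: binaryset_def disjoint_family_on_def)
  then have "(\<lambda>i. \<mu> (binaryset B C i)) sums \<mu> (\<Union>i. binaryset B C i)"
    using \<mu> unfolding finite_real_borel_measure_def by blast
  moreover have "(\<lambda>i. \<mu> (binaryset B C i)) sums (\<mu> B + \<mu> C)"
    using \<mu> by (intro binaryset_sums) (auto simp: finite_real_borel_measure_def)
  ultimately show ?thesis
    by (metis UN_binaryset_eq sums_unique2)
qed

lemma sets_neg_part_measure [simp, measurable_cong]: "sets (neg_part_measure \<mu>) = sets borel"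
  by (simp add: neg_part_measure_def)

text \<open>
  For \<open>\<ge>\<close>, the part \<open>\<mu> (B \<inter> C)\<close> cancels in \<open>\<mu> B - \<mu> C\<close>, so the difference is bounded through the disjoint sets
  \<open>B - C\<close> and \<open>C - B\<close>, which belong to a common partition of \<open>A\<close>.
\<close>

lemma total_variation_jordan:
  fixes \<mu> :: "'a::topological_space set \<Rightarrow> real"
  assumes \<mu>: "finite_real_borel_measure \<mu>" and A: "A \<in> sets borel"
  shows "total_variation \<mu> A = emeasure (pos_part_measure \<mu>) A + emeasure (neg_part_measure \<mu>) A"
proof (rule antisym)
  note \<mu>' = finite_real_borel_measure_uminus[OF \<mu>]
  show "total_variation \<mu> A \<le> emeasure (pos_part_measure \<mu>) A + emeasure (neg_part_measure \<mu>) A"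
    unfolding total_variation_def
  proof (rule SUP_least, clarify)
    fix P assume P: "finite P" "P \<subseteq> sets borel" "disjoint P" "A = \<Union>P"
    have sum_eq: "(\<Sum>B\<in>P. emeasure M B) = emeasure M (\<Union>P)" if "sets M = sets borel" for M
      using P that sum_emeasure[of "\<lambda>B. B" P M] by (auto simp: disjoint_def disjoint_family_on_def)
    have "(\<Sum>B\<in>P. ennreal \<bar>\<mu> B\<bar>) \<le> (\<Sum>B\<in>P. emeasure (pos_part_measure \<mu>) B + emeasure (neg_part_measure \<mu>) B)"
    proof (intro sum_mono)
      fix B assume "B \<in> P"
      then have B: "B \<in> sets borel"
        using P by auto
      have "ennreal (\<mu> B) \<le> emeasure (pos_part_measure \<mu>) B" "ennreal (- \<mu> B) \<le> emeasure (neg_part_measure \<mu>) B"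
        unfolding neg_part_measure_def emeasure_pos_part_measure[OF \<mu> B] emeasure_pos_part_measure[OF \<mu>' B]
        using B by (auto intro!: SUP_upper)
      then show "ennreal \<bar>\<mu> B\<bar> \<le> emeasure (pos_part_measure \<mu>) B + emeasure (neg_part_measure \<mu>) B"
        by (cases "\<mu> B \<ge> 0") (auto intro: add_increasing add_increasing2)
    qed
    also have "\<dots> = emeasure (pos_part_measure \<mu>) (\<Union>P) + emeasure (neg_part_measure \<mu>) (\<Union>P)"
      by (simp add: sum.distrib sum_eq)
    finally show "(\<Sum>B\<in>P. ennreal \<bar>\<mu> B\<bar>) \<le> emeasure (pos_part_measure \<mu>) (\<Union>P) + emeasure (neg_part_measure \<mu>) (\<Union>P)" .
  qed
next
  note \<mu>' = finite_real_borel_measure_uminus[OF \<mu>]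
  have emp: "\<mu> {} = 0"
    using \<mu> by (simp add: finite_real_borel_measure_def)
  have two: "ennreal \<bar>\<mu> B\<bar> + ennreal \<bar>\<mu> C\<bar> \<le> total_variation \<mu> A"
    if BC: "B \<in> sets borel" "C \<in> sets borel" "B \<inter> C = {}" "B \<subseteq> A" "C \<subseteq> A" for B C
  \<comment> \<open>If the disjoint sets \<open>B\<close> and \<open>C\<close> coincide, they are empty; the partition \<open>P\<close> below would count them once.\<close>
  proof (cases "B = C")
    case True
    with BC have "B = {}" "C = {}" by auto
    then show ?thesis by (simp add: emp)
  next
    case False
    define P where "P = {B, C, A - B - C}"
    have "ennreal \<bar>\<mu> B\<bar> + ennreal \<bar>\<mu> C\<bar> = (\<Sum>B\<in>{B, C}. ennreal \<bar>\<mu> B\<bar>)"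
      using False by simp
    also have "\<dots> \<le> (\<Sum>B\<in>P. ennreal \<bar>\<mu> B\<bar>)"
      by (intro sum_mono2) (auto simp: P_def)
    also have "\<dots> \<le> total_variation \<mu> A"
      unfolding total_variation_def
      using BC A by (intro SUP_upper) (auto simp: P_def disjoint_def)
    finally show ?thesis .
  qed
  have mixed: "ennreal (\<mu> B) + ennreal (- \<mu> C) \<le> total_variation \<mu> A"
    if BC: "B \<in> sets borel" "B \<subseteq> A" "C \<in> sets borel" "C \<subseteq> A" for B C
  proof -
    have *: "ennreal (\<mu> B) + ennreal (- \<mu> C) \<le> total_variation \<mu> A"
      if BC: "B \<in> sets borel" "B \<subseteq> A" "C \<in> sets borel" "C \<subseteq> A" and "0 \<le> \<mu> B" "\<mu> C \<le> 0" for B C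
    proof -
      have "\<mu> ((B \<inter> C) \<union> (B - C)) = \<mu> (B \<inter> C) + \<mu> (B - C)" "\<mu> ((B \<inter> C) \<union> (C - B)) = \<mu> (B \<inter> C) + \<mu> (C - B)"
        using BC by (intro finite_real_borel_measure_Un[OF \<mu>]; auto)+
      moreover have "(B \<inter> C) \<union> (B - C) = B" "(B \<inter> C) \<union> (C - B) = C"
        by auto
      ultimately have "\<mu> B - \<mu> C \<le> \<bar>\<mu> (B - C)\<bar> + \<bar>\<mu> (C - B)\<bar>"
        by simp
      moreover have "ennreal (\<mu> B) + ennreal (- \<mu> C) = ennreal (\<mu> B - \<mu> C)"
        using that by (subst ennreal_plus[symmetric]) auto
      ultimately have "ennreal (\<mu> B) + ennreal (- \<mu> C) \<le> ennreal (\<bar>\<mu> (B - C)\<bar> + \<bar>\<mu> (C - B)\<bar>)"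
        by (simp only: ennreal_leI)
      also have "\<dots> = ennreal \<bar>\<mu> (B - C)\<bar> + ennreal \<bar>\<mu> (C - B)\<bar>"
        by (rule ennreal_plus) auto
      also have "\<dots> \<le> total_variation \<mu> A"
        using BC by (intro two) auto
      finally show ?thesis .
    qed
    show ?thesis
      using *[OF BC] *[OF BC(1,2), of "{}"] *[of "{}", OF _ _ BC(3,4)] emp
      by (cases "0 \<le> \<mu> B"; cases "\<mu> C \<le> 0") (auto simp: ennreal_neg)
  qed
  have ne: "{B \<in> sets borel. B \<subseteq> A} \<noteq> {}"
    by auto
  have "emeasure (pos_part_measure \<mu>) A + emeasure (neg_part_measure \<mu>) A =
      (SUP B\<in>{B \<in> sets borel. B \<subseteq> A}. SUP C\<in>{C \<in> sets borel. C \<subseteq> A}. ennreal (\<mu> B) + ennreal (- \<mu> C))"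
    unfolding neg_part_measure_def emeasure_pos_part_measure[OF \<mu> A] emeasure_pos_part_measure[OF \<mu>' A]
    by (simp only: ennreal_SUP_add_left[OF ne] ennreal_SUP_add_right[OF ne, symmetric])
  also have "\<dots> \<le> total_variation \<mu> A"
    using mixed by (intro SUP_least) auto
  finally show "emeasure (pos_part_measure \<mu>) A + emeasure (neg_part_measure \<mu>) A \<le> total_variation \<mu> A" .
qed

lemma radon_abs_measure:
  fixes \<mu> :: "'a::t2_space set \<Rightarrow> real"
  assumes \<mu>: "radon_real_measure \<mu>"
  defines "\<nu> \<equiv> plus_measure (pos_part_measure \<mu>) (neg_part_measure \<mu>)"
  shows "inner_regular \<nu>" "emeasure \<nu> UNIV = total_variation \<mu> UNIV"
proof -
  have eq: "emeasure \<nu> A = total_variation \<mu> A" if "A \<in> sets borel" for A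
    using that \<mu> by (simp add: \<nu>_def emeasure_plus_measure total_variation_jordan radon_real_measure_def)
  then show "emeasure \<nu> UNIV = total_variation \<mu> UNIV"
    by simp
  have "(SUP K\<in>{K. compact K \<and> K \<subseteq> A}. emeasure \<nu> K) = (SUP K\<in>{K. compact K \<and> K \<subseteq> A}. total_variation \<mu> K)" for A
    using eq compact_in_borel by (intro SUP_cong) auto
  then show "inner_regular \<nu>"
    using \<mu> eq by (simp add: inner_regular_def radon_real_measure_def \<nu>_def)
qed

text \<open>
  The inequality \<open>\<bar>\<mu> * k\<bar> \<le> \<bar>\<mu>\<bar> * k\<close>. It persists where \<open>\<mu> * k\<close> is \<open>\<infinity> - \<infinity>\<close>, since there the right-hand side
  is infinite.
\<close>

lemma abs_conv_meas_le:
  fixes \<mu> :: "'a::{topological_group_add, t2_space} set \<Rightarrow> real"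
  assumes k: "k \<in> borel_measurable borel" "\<And>x. 0 \<le> k x"
  shows "\<bar>conv_meas \<mu> k x\<bar> \<le>
    enn2ereal (\<integral>\<^sup>+y. ennreal (k (- y + x)) \<partial>plus_measure (pos_part_measure \<mu>) (neg_part_measure \<mu>))"
proof -
  note [measurable] = k(1)
  let ?P = "\<integral>\<^sup>+y. ennreal (k (- y + x)) \<partial>pos_part_measure \<mu>"
  let ?N = "\<integral>\<^sup>+y. ennreal (k (- y + x)) \<partial>neg_part_measure \<mu>"
  have "(\<integral>\<^sup>+y. ennreal (k (- y + x)) \<partial>plus_measure (pos_part_measure \<mu>) (neg_part_measure \<mu>)) = ?P + ?N"
    by (intro nn_integral_plus_measure) auto
  moreover have "conv_meas \<mu> k x = enn2ereal ?P - enn2ereal ?N"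
    using k(2) by (simp add: conv_meas_def ennreal_neg)
  moreover have "\<bar>a - b\<bar> \<le> a + b" if "0 \<le> a" "0 \<le> b" for a b :: ereal
    using that by (cases a; cases b) auto
  ultimately show ?thesis
    by (simp add: plus_ennreal.rep_eq)
qed

text \<open>
  The supremum of \<open>\<integral>\<^sub>B f\<close> over \<open>B \<subseteq> A\<close> is attained at \<open>B = A \<inter> {f > 0}\<close>, which identifies the
  positive part.
\<close>

lemma indefinite_integral_real_measure:
  fixes lam :: "'a::topological_space measure"
  assumes s: "sets lam = sets borel" and f: "integrable lam f"
  shows "finite_real_borel_measure (\<lambda>A. \<integral>x. f x * indicator A x \<partial>lam)"
    "pos_part_measure (\<lambda>A. \<integral>x. f x * indicator A x \<partial>lam) = density lam (\<lambda>x. ennreal (f x))"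
proof -
  note [measurable_cong] = s
  have [measurable]: "f \<in> borel_measurable borel"
    using borel_measurable_integrable[OF f] by (simp add: measurable_cong_sets[OF s refl])
  have intA: "integrable lam (\<lambda>x. f x * indicator A x)" if "A \<in> sets borel" for A
    using that s integrable_mult_indicator[OF _ f, of A] by (simp add: mult.commute)
  show fin: "finite_real_borel_measure (\<lambda>A. \<integral>x. f x * indicator A x \<partial>lam)"
    unfolding finite_real_borel_measure_def
  proof (intro conjI allI impI)
    fix F :: "nat \<Rightarrow> 'a set" assume F: "range F \<subseteq> sets borel" "disjoint_family F"
    have Fm [measurable]: "F i \<in> sets borel" for i
      using F(1) by auto
    have one: "(\<lambda>i. indicator (F i) x :: real) sums indicator (\<Union>i. F i) x" for x
      using indicator_sums[of F x] F(2) by (auto simp: disjoint_family_on_def)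
    have "(\<lambda>n. \<integral>x. (\<Sum>i<n. f x * indicator (F i) x) \<partial>lam) \<longlonglongrightarrow> (\<integral>x. f x * indicator (\<Union>i. F i) x \<partial>lam)"
    proof (rule integral_dominated_convergence)
      show "integrable lam (\<lambda>x. \<bar>f x\<bar>)"
        using f by simp
      show "AE x in lam. (\<lambda>n. \<Sum>i<n. f x * indicator (F i) x) \<longlonglongrightarrow> f x * indicator (\<Union>i. F i) x"
        using sums_mult[OF one] by (auto simp: sums_def)
      show "AE x in lam. norm (\<Sum>i<n. f x * indicator (F i) x) \<le> \<bar>f x\<bar>" for n
      proof (rule AE_I2)
        fix x
        have "(\<Sum>i<n. indicator (F i) x :: real) \<le> indicator (\<Union>i. F i) x"
          using sum_le_suminf[OF sums_summable[OF one], of "{..<n}" x] sums_unique[OF one, of x] by simp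
        also have "\<dots> \<le> 1"
          by (simp split: split_indicator)
        finally have "\<bar>f x\<bar> * (\<Sum>i<n. indicator (F i) x) \<le> \<bar>f x\<bar> * 1"
          by (intro mult_left_mono) auto
        moreover have "norm (\<Sum>i<n. f x * indicator (F i) x) = \<bar>f x\<bar> * (\<Sum>i<n. indicator (F i) x)"
          by (simp only: sum_distrib_left[symmetric] real_norm_def abs_mult)
             (simp only: abs_of_nonneg[OF sum_nonneg[of "{..<n}" "\<lambda>i. indicator (F i) x :: real"]] indicator_pos_le)
        ultimately show "norm (\<Sum>i<n. f x * indicator (F i) x) \<le> \<bar>f x\<bar>"
          by simp
      qed
    qed measurable
    then show "(\<lambda>i. \<integral>x. f x * indicator (F i) x \<partial>lam) sums (\<integral>x. f x * indicator (\<Union>i. F i) x \<partial>lam)"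
      using intA[OF Fm] by (simp only: sums_def Bochner_Integration.integral_sum)
  qed simp
  show "pos_part_measure (\<lambda>A. \<integral>x. f x * indicator A x \<partial>lam) = density lam (\<lambda>x. ennreal (f x))"
  proof (rule measure_eqI)
    fix A assume "A \<in> sets (pos_part_measure (\<lambda>A. \<integral>x. f x * indicator A x \<partial>lam))"
    then have A [measurable]: "A \<in> sets borel"
      by simp
    define m where "m x = max 0 (f x) * indicator A x" for x
    have m: "integrable lam m"
    proof (rule Bochner_Integration.integrable_bound[OF f])
      show "AE x in lam. norm (m x) \<le> norm (f x)"
        by (auto simp: m_def split: split_indicator)
      show "m \<in> borel_measurable lam"
        unfolding m_def by measurable
    qed
    have m0: "0 \<le> m x" for x
      by (simp add: m_def)
    have "emeasure (pos_part_measure (\<lambda>A. \<integral>x. f x * indicator A x \<partial>lam)) A =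
        (SUP B\<in>{B \<in> sets borel. B \<subseteq> A}. ennreal (\<integral>x. f x * indicator B x \<partial>lam))"
      by (rule emeasure_pos_part_measure[OF fin A])
    also have "\<dots> = ennreal (\<integral>x. m x \<partial>lam)"
    proof (rule antisym)
      show "(SUP B\<in>{B \<in> sets borel. B \<subseteq> A}. ennreal (\<integral>x. f x * indicator B x \<partial>lam)) \<le> ennreal (\<integral>x. m x \<partial>lam)"
      proof (intro SUP_least ennreal_leI)
        fix B assume "B \<in> {B \<in> sets borel. B \<subseteq> A}"
        then show "(\<integral>x. f x * indicator B x \<partial>lam) \<le> (\<integral>x. m x \<partial>lam)"
          by (intro integral_mono intA m) (auto simp: m_def split: split_indicator)
      qed
      have "(\<integral>x. m x \<partial>lam) = (\<integral>x. f x * indicator (A \<inter> {x. 0 < f x}) x \<partial>lam)"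
        by (intro Bochner_Integration.integral_cong) (auto simp: m_def split: split_indicator)
      moreover have "A \<inter> {x. 0 < f x} \<in> sets borel"
        by measurable
      ultimately show "ennreal (\<integral>x. m x \<partial>lam) \<le> (SUP B\<in>{B \<in> sets borel. B \<subseteq> A}. ennreal (\<integral>x. f x * indicator B x \<partial>lam))"
        by (intro SUP_upper2[of "A \<inter> {x. 0 < f x}"]) auto
    qed
    also have "\<dots> = (\<integral>\<^sup>+x. ennreal (m x) \<partial>lam)"
      using nn_integral_eq_integral[OF m] m0 by simp
    also have "\<dots> = (\<integral>\<^sup>+x. ennreal (f x) * indicator A x \<partial>lam)"
      by (intro nn_integral_cong) (auto simp: m_def max_def ennreal_neg split: split_indicator)
    also have "\<dots> = emeasure (density lam (\<lambda>x. ennreal (f x))) A"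
      by (rule emeasure_density[symmetric]) (auto simp: s)
    finally show "emeasure (pos_part_measure (\<lambda>A. \<integral>x. f x * indicator A x \<partial>lam)) A =
        emeasure (density lam (\<lambda>x. ennreal (f x))) A" .
  qed (simp add: s)
qed

lemma indefinite_integral_radon:
  fixes lam :: "'a::t2_space measure"
  assumes lam: "inner_regular lam" and f: "integrable lam f"
  defines "\<mu> \<equiv> \<lambda>A. \<integral>x. f x * indicator A x \<partial>lam"
  shows "neg_part_measure \<mu> = density lam (\<lambda>x. ennreal (- f x))"
    and "radon_real_measure \<mu>" and "total_variation \<mu> UNIV = ennreal (\<integral>x. \<bar>f x\<bar> \<partial>lam)"
proof -
  note s = inner_regular_sets[OF lam]
  note [measurable_cong] = s
  have [measurable]: "f \<in> borel_measurable borel"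
    using borel_measurable_integrable[OF f] by (simp add: measurable_cong_sets[OF s refl])
  have \<mu>: "finite_real_borel_measure \<mu>" and pos: "pos_part_measure \<mu> = density lam (\<lambda>x. ennreal (f x))"
    unfolding \<mu>_def by (rule indefinite_integral_real_measure[OF s f])+
  show neg: "neg_part_measure \<mu> = density lam (\<lambda>x. ennreal (- f x))"
    using indefinite_integral_real_measure(2)[OF s, of "\<lambda>x. - f x"] f
    by (simp add: neg_part_measure_def \<mu>_def)
  have tv: "total_variation \<mu> A = emeasure (density lam (\<lambda>x. ennreal \<bar>f x\<bar>)) A" if [measurable]: "A \<in> sets borel" for A
  proof -
    have "total_variation \<mu> A = (\<integral>\<^sup>+x. ennreal (f x) * indicator A x \<partial>lam) + (\<integral>\<^sup>+x. ennreal (- f x) * indicator A x \<partial>lam)"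
      by (simp add: total_variation_jordan[OF \<mu>] pos neg emeasure_density s)
    also have "\<dots> = (\<integral>\<^sup>+x. ennreal (f x) * indicator A x + ennreal (- f x) * indicator A x \<partial>lam)"
      by (intro nn_integral_add[symmetric]) measurable
    also have "\<dots> = (\<integral>\<^sup>+x. ennreal \<bar>f x\<bar> * indicator A x \<partial>lam)"
      by (intro nn_integral_cong) (auto simp: abs_if ennreal_neg split: split_indicator)
    finally show ?thesis
      by (simp add: emeasure_density s)
  qed
  have int: "(\<integral>\<^sup>+x. ennreal \<bar>f x\<bar> \<partial>lam) = ennreal (\<integral>x. \<bar>f x\<bar> \<partial>lam)"
    using f by (intro nn_integral_eq_integral) auto
  then show "total_variation \<mu> UNIV = ennreal (\<integral>x. \<bar>f x\<bar> \<partial>lam)"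
    by (simp add: tv emeasure_density s)
  have reg: "inner_regular (density lam (\<lambda>x. ennreal \<bar>f x\<bar>))"
    by (rule inner_regular_density[OF lam]) (auto simp: int)
  have "(SUP K\<in>{K. compact K \<and> K \<subseteq> A}. total_variation \<mu> K) =
      (SUP K\<in>{K. compact K \<and> K \<subseteq> A}. emeasure (density lam (\<lambda>x. ennreal \<bar>f x\<bar>)) K)" for A
    using tv compact_in_borel by (intro SUP_cong) auto
  then show "radon_real_measure \<mu>"
    using \<mu> reg tv by (simp add: inner_regular_def radon_real_measure_def)
qed

section \<open>Transfer of weak type inequalities\<close>

lemma ennreal_mult_le_imp_le_divide:
  assumes "0 < a" "0 \<le> b" "ennreal a * X \<le> ennreal b"
  shows "X \<le> ennreal (b / a)"
proof (cases X)
  case top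
  then show ?thesis
    using assms by (simp add: ennreal_mult_top top_unique)
next
  case (real r)
  then have "a * r \<le> b"
    using assms by (simp flip: ennreal_mult)
  then have "r \<le> b / a"
    using assms(1) by (simp add: pos_le_divide_eq mult.commute)
  then show ?thesis
    using real by (simp add: ennreal_leI)
qed

lemma weak_type_fun_nonneg:
  fixes lam :: "'a::topological_group_add measure"
  assumes wt: "weak_type_fun lam I k c" and k: "\<And>\<beta> x. \<beta> \<in> I \<Longrightarrow> 0 \<le> k \<beta> x"
    and f: "integrable lam f" "\<And>x. 0 \<le> f x" and \<alpha>: "0 < \<alpha>"
  shows "ennreal \<alpha> * outer_measure_of lam
      {x. \<exists>\<beta>\<in>I. ennreal \<alpha> < (\<integral>\<^sup>+y. ennreal (k \<beta> (- y + x)) * ennreal (f y) \<partial>lam)} \<le> ennreal (c * (\<integral>x. f x \<partial>lam))"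
proof -
  have "\<bar>conv_fun lam f (k \<beta>) x\<bar> = enn2ereal (\<integral>\<^sup>+y. ennreal (k \<beta> (- y + x)) * ennreal (f y) \<partial>lam)"
    if "\<beta> \<in> I" for \<beta> x
    using k[OF that] f(2) by (simp add: conv_fun_def ennreal_neg ennreal_mult zero_ennreal.rep_eq)
  then have "{x. \<exists>\<beta>\<in>I. ennreal \<alpha> < (\<integral>\<^sup>+y. ennreal (k \<beta> (- y + x)) * ennreal (f y) \<partial>lam)} =
      {x. ereal \<alpha> < maximal_fun lam I k f x}"
    using \<alpha> by (auto simp: maximal_fun_def less_SUP_iff less_ennreal.rep_eq enn2ereal_ennreal)
  then show ?thesis
    using wt[unfolded weak_type_fun_def, rule_format, OF f(1) \<alpha>] f(2) by simp
qed

text \<open>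
  Passing from \<open>\<mu>\<close> to \<open>\<bar>\<mu>\<bar>\<close> only enlarges the level sets, so it suffices to treat positive measures. If
  \<open>\<bar>\<mu>\<bar>(X)\<close> is infinite, there is nothing to prove, as \<open>c > 0\<close>.
\<close>

lemma weak_type_meas_if_positive:
  fixes lam :: "'a::{topological_group_add, t2_space} measure"
  assumes k: "\<And>\<beta> x. \<beta> \<in> I \<Longrightarrow> 0 \<le> k \<beta> x" "\<And>\<beta>. \<beta> \<in> I \<Longrightarrow> k \<beta> \<in> borel_measurable borel" and c: "0 < c"
    and pos: "\<And>\<nu> \<alpha>. inner_regular \<nu> \<Longrightarrow> emeasure \<nu> UNIV < \<infinity> \<Longrightarrow> 0 < \<alpha> \<Longrightarrow>
      ennreal \<alpha> * outer_measure_of lam {x. \<exists>\<beta>\<in>I. ennreal \<alpha> < (\<integral>\<^sup>+y. ennreal (k \<beta> (- y + x)) \<partial>\<nu>)}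
        \<le> ennreal c * emeasure \<nu> UNIV"
  shows "weak_type_meas lam I k c"
  unfolding weak_type_meas_def
proof (intro allI impI)
  fix \<mu> :: "'a set \<Rightarrow> real" and \<alpha> :: real
  assume \<mu>: "radon_real_measure \<mu>" and \<alpha>: "0 < \<alpha>"
  define \<nu> where "\<nu> = plus_measure (pos_part_measure \<mu>) (neg_part_measure \<mu>)"
  have \<nu>: "inner_regular \<nu>" "emeasure \<nu> UNIV = total_variation \<mu> UNIV"
    unfolding \<nu>_def by (rule radon_abs_measure[OF \<mu>])+
  show "ennreal \<alpha> * outer_measure_of lam {x. ereal \<alpha> < maximal_meas I k \<mu> x} \<le> ennreal c * total_variation \<mu> UNIV"
  proof (cases "total_variation \<mu> UNIV = \<infinity>")
    case True
    then show ?thesis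
      using c by (simp add: ennreal_mult_top)
  next
    case False
    have "ennreal \<alpha> < (\<integral>\<^sup>+y. ennreal (k \<beta> (- y + x)) \<partial>\<nu>)"
      if "\<beta> \<in> I" "ereal \<alpha> < \<bar>conv_meas \<mu> (k \<beta>) x\<bar>" for \<beta> x
    proof -
      have "ereal \<alpha> < enn2ereal (\<integral>\<^sup>+y. ennreal (k \<beta> (- y + x)) \<partial>\<nu>)"
        unfolding \<nu>_def using that k by (intro less_le_trans[OF that(2) abs_conv_meas_le]) auto
      then show ?thesis
        using \<alpha> by (simp add: less_ennreal.rep_eq enn2ereal_ennreal)
    qed
    then have "{x. ereal \<alpha> < maximal_meas I k \<mu> x} \<subseteq> {x. \<exists>\<beta>\<in>I. ennreal \<alpha> < (\<integral>\<^sup>+y. ennreal (k \<beta> (- y + x)) \<partial>\<nu>)}"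
      by (auto simp: maximal_meas_def less_SUP_iff)
    then have "ennreal \<alpha> * outer_measure_of lam {x. ereal \<alpha> < maximal_meas I k \<mu> x} \<le>
        ennreal \<alpha> * outer_measure_of lam {x. \<exists>\<beta>\<in>I. ennreal \<alpha> < (\<integral>\<^sup>+y. ennreal (k \<beta> (- y + x)) \<partial>\<nu>)}"
      by (intro mult_left_mono outer_measure_of_mono) auto
    also have "\<dots> \<le> ennreal c * emeasure \<nu> UNIV"
      using \<nu> \<alpha> False by (intro pos) (auto simp: less_top)
    finally show ?thesis
      by (simp add: \<nu>(2))
  qed
qed

text \<open>
  An integrable function \<open>f\<close> is the Radon measure \<open>f d\<lambda>\<close>, with the same convolutions and with total variation
  \<open>\<parallel>f\<parallel>\<^sub>1\<close>.
\<close>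

lemma weak_type_fun_if_meas:
  fixes lam :: "'a::{topological_group_add, t2_space} measure"
  assumes lam: "inner_regular lam" and c: "0 < c"
    and k: "\<And>\<beta> x. \<beta> \<in> I \<Longrightarrow> 0 \<le> k \<beta> x" "\<And>\<beta>. \<beta> \<in> I \<Longrightarrow> k \<beta> \<in> borel_measurable borel"
    and wt: "weak_type_meas lam I k c"
  shows "weak_type_fun lam I k c"
  unfolding weak_type_fun_def
proof (intro allI impI)
  fix f :: "'a \<Rightarrow> real" and \<alpha> :: real
  assume f: "integrable lam f" and \<alpha>: "0 < \<alpha>"
  note s = inner_regular_sets[OF lam]
  note [measurable_cong] = s
  have [measurable]: "f \<in> borel_measurable borel"
    using borel_measurable_integrable[OF f] by (simp add: measurable_cong_sets[OF s refl])
  define \<mu> where "\<mu> A = (\<integral>x. f x * indicator A x \<partial>lam)" for A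
  have \<mu>_eq: "\<mu> = (\<lambda>A. \<integral>x. f x * indicator A x \<partial>lam)"
    by (auto simp: \<mu>_def)
  have pos: "pos_part_measure \<mu> = density lam (\<lambda>x. ennreal (f x))"
    unfolding \<mu>_eq by (rule indefinite_integral_real_measure[OF s f])
  have neg: "neg_part_measure \<mu> = density lam (\<lambda>x. ennreal (- f x))"
    and rad: "radon_real_measure \<mu>" and tv: "total_variation \<mu> UNIV = ennreal (\<integral>x. \<bar>f x\<bar> \<partial>lam)"
    unfolding \<mu>_eq by (rule indefinite_integral_radon[OF lam f])+
  have "conv_meas \<mu> (k \<beta>) x = conv_fun lam f (k \<beta>) x" if "\<beta> \<in> I" for \<beta> x
  proof -
    note [measurable] = k(2)[OF that]
    have "(\<integral>\<^sup>+y. ennreal (k \<beta> (- y + x)) \<partial>density lam (\<lambda>x. ennreal (g x))) =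
        (\<integral>\<^sup>+y. ennreal (k \<beta> (- y + x) * g y) \<partial>lam)" if [measurable]: "g \<in> borel_measurable borel" for g
    proof -
      have "(\<integral>\<^sup>+y. ennreal (k \<beta> (- y + x)) \<partial>density lam (\<lambda>x. ennreal (g x))) =
          (\<integral>\<^sup>+y. ennreal (g y) * ennreal (k \<beta> (- y + x)) \<partial>lam)"
        by (intro nn_integral_density) measurable
      also have "\<dots> = (\<integral>\<^sup>+y. ennreal (k \<beta> (- y + x) * g y) \<partial>lam)"
        unfolding ennreal_mult'[OF k(1)[OF \<open>\<beta> \<in> I\<close>]] by (intro nn_integral_cong mult.commute)
      finally show ?thesis .
    qed
    note dens = this
    have split: "(\<integral>\<^sup>+y. ennreal (k \<beta> (- y + x)) \<partial>density lam (\<lambda>x. ennreal (f x))) =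
          (\<integral>\<^sup>+y. ennreal (k \<beta> (- y + x) * f y) \<partial>lam)"
        "(\<integral>\<^sup>+y. ennreal (k \<beta> (- y + x)) \<partial>density lam (\<lambda>x. ennreal (- f x))) =
          (\<integral>\<^sup>+y. ennreal (k \<beta> (- y + x) * - f y) \<partial>lam)"
      by (intro dens; measurable)+
    have zero: "ennreal (- k \<beta> (- y + x)) = 0" for y
      using k(1)[OF that] by (simp add: ennreal_neg)
    show ?thesis
      unfolding conv_meas_def conv_fun_def pos neg zero split by simp
  qed
  then have "maximal_meas I k \<mu> x = maximal_fun lam I k f x" for x
    by (simp add: maximal_meas_def maximal_fun_def)
  then have "ennreal \<alpha> * outer_measure_of lam {x. ereal \<alpha> < maximal_fun lam I k f x} \<le> ennreal c * total_variation \<mu> UNIV"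
    using wt[unfolded weak_type_meas_def, rule_format, OF rad \<alpha>] by simp
  also have "\<dots> = ennreal (c * (\<integral>x. \<bar>f x\<bar> \<partial>lam))"
    using c by (simp add: tv ennreal_mult)
  finally show "ennreal \<alpha> * outer_measure_of lam {x. ereal \<alpha> < maximal_fun lam I k f x} \<le> ennreal (c * (\<integral>x. \<bar>f x\<bar> \<partial>lam))" .
qed

text \<open>
  The level set is open, hence its measure is the supremum over its compact subsets \<open>K\<close>. On \<open>K\<close> the measure
  is replaced by an integrable function, to which the hypothesis applies. Uncountable
  families are harmless, because arbitrary unions of open sets are open.
\<close>

lemma weak_type_positive_lsc:
  fixes lam :: "'a::{topological_group_add, t2_space} measure"
  assumes lam: "left_haar_measure lam" and c: "0 < c"
    and k: "\<And>\<beta> x. \<beta> \<in> I \<Longrightarrow> 0 \<le> k \<beta> x" "\<And>\<beta>. \<beta> \<in> I \<Longrightarrow> lower_semicontinuous (k \<beta>)"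
    and wt: "weak_type_fun lam I k c"
    and \<nu>: "inner_regular \<nu>" "emeasure \<nu> UNIV < \<infinity>" and \<alpha>: "0 < \<alpha>"
  shows "ennreal \<alpha> * outer_measure_of lam {x. \<exists>\<beta>\<in>I. ennreal \<alpha> < (\<integral>\<^sup>+y. ennreal (k \<beta> (- y + x)) \<partial>\<nu>)}
        \<le> ennreal c * emeasure \<nu> UNIV"
proof -
  let ?E = "{x. \<exists>\<beta>\<in>I. ennreal \<alpha> < (\<integral>\<^sup>+y. ennreal (k \<beta> (- y + x)) \<partial>\<nu>)}"
  note reg = left_haar_inner_regular[OF lam]
  note s = inner_regular_sets[OF reg]
  have lsc: "lsc (\<lambda>x. ennreal (k \<beta> x))" if "\<beta> \<in> I" for \<beta>
    using k that by (intro lsc_ennreal) auto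
  have "open {x. ennreal \<alpha> < (\<integral>\<^sup>+y. ennreal (k \<beta> (- y + x)) \<partial>\<nu>)}" if "\<beta> \<in> I" for \<beta>
    using lsc_convolution[OF \<nu> lsc[OF that]] by (simp add: lsc_def)
  then have "open ?E"
    unfolding Collect_bex_eq by (intro open_UN) auto
  then have E: "?E \<in> sets borel"
    by (rule borel_open)
  have "ennreal \<alpha> * emeasure lam K \<le> ennreal c * emeasure \<nu> UNIV" if K: "compact K" "K \<subseteq> ?E" for K
  proof -
    have large: "\<exists>\<beta>\<in>I. ennreal \<alpha> < (\<integral>\<^sup>+y. ennreal (k \<beta> (- y + x)) \<partial>\<nu>)" if "x \<in> K" for x
      using that K(2) by auto
    obtain f :: "'a \<Rightarrow> real" where f: "\<And>y. 0 \<le> f y" "integrable lam f" "ennreal (\<integral>y. f y \<partial>lam) \<le> emeasure \<nu> UNIV"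
        "\<And>x. x \<in> K \<Longrightarrow> \<exists>\<beta>\<in>I. ennreal \<alpha> < (\<integral>\<^sup>+y. ennreal (k \<beta> (- y + x)) * ennreal (f y) \<partial>lam)"
      by (rule convolution_step_function[OF lam \<nu> _ K(1), of I "\<lambda>\<beta> x. ennreal (k \<beta> x)" "ennreal \<alpha>"])
        (rule lsc large that; assumption)+
    have "ennreal \<alpha> * emeasure lam K = ennreal \<alpha> * outer_measure_of lam K"
      using compact_in_borel[OF K(1)] s by simp
    also have "\<dots> \<le> ennreal \<alpha> * outer_measure_of lam {x. \<exists>\<beta>\<in>I. ennreal \<alpha> < (\<integral>\<^sup>+y. ennreal (k \<beta> (- y + x)) * ennreal (f y) \<partial>lam)}"
      using f(4) by (intro mult_left_mono outer_measure_of_mono) auto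
    also have "\<dots> \<le> ennreal (c * (\<integral>y. f y \<partial>lam))"
      by (rule weak_type_fun_nonneg[OF wt k(1) f(2,1) \<alpha>])
    also have "\<dots> = ennreal c * ennreal (\<integral>y. f y \<partial>lam)"
      using c f(1) by (intro ennreal_mult integral_nonneg_AE) auto
    also have "\<dots> \<le> ennreal c * emeasure \<nu> UNIV"
      using f(3) by (intro mult_left_mono) auto
    finally show ?thesis .
  qed
  moreover have "outer_measure_of lam ?E = (SUP K\<in>{K. compact K \<and> K \<subseteq> ?E}. emeasure lam K)"
    using E reg s by (simp add: inner_regular_def)
  ultimately show ?thesis
    by (auto simp: SUP_mult_left_ennreal intro!: SUP_least)
qed

lemma compact_Minkowski_difference:
  fixes L K :: "'a::topological_group_add set"
  assumes "compact L" "compact K"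
  shows "compact ((\<lambda>p. - fst p + snd p) ` (L \<times> K))"
proof (rule compact_continuous_image)
  have "((\<lambda>p. - fst p + snd p) \<longlongrightarrow> - fst x + snd x) (at x within L \<times> K)" for x
    by (intro tendsto_add tendsto_minus tendsto_fst tendsto_snd tendsto_ident_at)
  then show "continuous_on (L \<times> K) (\<lambda>p. - fst p + snd p)"
    unfolding continuous_on_def by blast
qed (intro compact_Times assms)

text \<open>
  The kernels are majorized by lower semicontinuous \<open>k' n\<close> with \<open>k' n \<le> max (k n) (h n)\<close> and small
  \<open>\<integral> h n\<close>. For the \<open>k' n\<close> the measure \<open>\<nu>\<close> can be replaced by a function \<open>f\<close> on \<open>K\<close>. Where \<open>f * k' n > \<alpha>\<close>, either
  \<open>f * k n > \<alpha> - \<delta>\<close>, which the hypothesis controls, or \<open>f * H > \<delta>\<close> with \<open>H = sup h n\<close>, which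
  the weak type estimate for the lower semicontinuous \<open>H\<close> controls. The majorants need kernels supported
  in a \<open>\<sigma>\<close>-compact set; as \<open>\<nu>\<close> lives on \<open>\<Union>n. L n\<close> and \<open>x\<close> stays in \<open>K\<close>, cutting the kernels down to the sets
  \<open>- L n + K\<close> changes nothing.
\<close>

lemma weak_type_positive_borel_approx:
  fixes lam :: "'a::{topological_group_add, t2_space} measure" and k :: "nat \<Rightarrow> 'a \<Rightarrow> real"
  assumes lc: "locally_compact_space (euclidean :: 'a topology)" and lam: "left_haar_measure lam" and c: "0 < c"
    and k: "\<And>n x. 0 \<le> k n x" "\<And>n. k n \<in> borel_measurable borel"
    and wt: "weak_type_fun lam UNIV k c"
    and \<nu>: "inner_regular \<nu>" "emeasure \<nu> UNIV < \<infinity>" and \<delta>: "0 < \<delta>" "\<delta> < \<alpha>"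
    and K: "compact K" "\<And>x. x \<in> K \<Longrightarrow> \<exists>n. ennreal \<alpha> < (\<integral>\<^sup>+y. ennreal (k n (- y + x)) \<partial>\<nu>)"
  shows "emeasure lam K \<le> ennreal (c * measure \<nu> UNIV / (\<alpha> - \<delta>) + measure \<nu> UNIV * \<delta>)"
proof -
  note reg = left_haar_inner_regular[OF lam]
  note s = inner_regular_sets[OF reg]
  note [measurable_cong] = s inner_regular_sets[OF \<nu>(1)]
  note [measurable] = k(2)
  define N where "N = measure \<nu> UNIV"
  have N: "emeasure \<nu> UNIV = ennreal N"
    using \<nu>(2) by (simp add: N_def emeasure_eq_ennreal_measure less_top)
  have N0: "0 \<le> N"
    by (simp add: N_def)
  obtain L :: "nat \<Rightarrow> 'a set" where L: "\<And>n. compact (L n)" "emeasure \<nu> (UNIV - (\<Union>n. L n)) = 0"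
    using inner_regular_exhaustion[OF \<nu>(1) _ \<nu>(2)] by auto
  define Q where "Q n = (\<lambda>p. - fst p + snd p) ` (L n \<times> K)" for n
  have Qc: "compact (Q n)" for n
    unfolding Q_def by (rule compact_Minkowski_difference[OF L(1) K(1)])
  have Qm [measurable]: "(\<Union>n. Q n) \<in> sets borel"
    using compact_in_borel[OF Qc] by (intro sets.countable_UN) auto
  define \<kappa> where "\<kappa> n x = ennreal (k n x) * indicator (\<Union>n. Q n) x" for n x
  have \<kappa>m [measurable]: "\<kappa> n \<in> borel_measurable borel" for n
    unfolding \<kappa>_def by measurable
  have \<kappa>_le: "\<kappa> n x \<le> ennreal (k n x)" for n x
    by (simp add: \<kappa>_def split: split_indicator)
  have supp: "{x. 0 < \<kappa> n x} \<subseteq> (\<Union>n. Q n)" for n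
    by (auto simp: \<kappa>_def split: split_indicator_asm)
  have AE_L: "AE y in \<nu>. y \<in> (\<Union>n. L n)"
  proof (rule AE_I)
    show "UNIV - (\<Union>n. L n) \<in> sets \<nu>"
      using compact_in_borel[OF L(1)] by (auto simp: inner_regular_sets[OF \<nu>(1)])
  qed (use L(2) in auto)
  have int_eq: "(\<integral>\<^sup>+y. \<kappa> n (- y + x) \<partial>\<nu>) = (\<integral>\<^sup>+y. ennreal (k n (- y + x)) \<partial>\<nu>)" if "x \<in> K" for n x
  proof (rule nn_integral_cong_AE)
    show "AE y in \<nu>. \<kappa> n (- y + x) = ennreal (k n (- y + x))"
      using AE_L
    proof eventually_elim
      case (elim y)
      then obtain p where "y \<in> L p" by auto
      then have "- y + x \<in> Q p"
        unfolding Q_def using that by (intro image_eqI[of _ _ "(y, x)"]) auto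
      then have "- y + x \<in> (\<Union>n. Q n)"
        by blast
      then show ?case
        unfolding \<kappa>_def by (simp only: indicator_simps(1)) simp
    qed
  qed
  \<comment> \<open>The total error \<open>\<integral> H \<le> \<delta>\<^sup>2\<close> leaves \<open>\<delta>\<^sup>2 / \<delta> = \<delta>\<close> after the level \<open>\<delta>\<close> has been divided out.\<close>
  have \<delta>2: "0 < \<delta>\<^sup>2"
    using \<delta> by simp
  obtain e where e: "\<And>n. 0 < e n" "(\<Sum>n. ennreal (e n)) = ennreal (\<delta>\<^sup>2)"
    by (rule summable_tolerances[OF \<delta>2]) (rule that; assumption)
  have "\<exists>k' h. lsc k' \<and> lsc h \<and> (\<forall>x. \<kappa> n x \<le> k' x) \<and> (\<forall>x. k' x \<le> max (\<kappa> n x) (h x)) \<and>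
      (\<integral>\<^sup>+x. h x \<partial>lam) \<le> ennreal (e n)" for n
  proof -
    have Mfin: "emeasure lam K < \<infinity>" if "compact K" for K
      using lam that by (simp add: left_haar_measure_def)
    obtain k' h where kh: "lsc k'" "lsc h" "\<And>x. \<kappa> n x \<le> k' x" "\<And>x. k' x \<le> max (\<kappa> n x) (h x)"
        "(\<integral>\<^sup>+x. h x \<partial>lam) \<le> ennreal (e n)"
      by (rule lsc_majorant[OF lc reg Mfin \<kappa>m supp Qc e(1)]) (assumption | rule that; assumption)+
    show ?thesis
      by (intro exI[of _ k'] exI[of _ h] conjI allI kh)
  qed
  then obtain k' h where kh: "\<And>n. lsc (k' n)" "\<And>n. lsc (h n)" "\<And>n x. \<kappa> n x \<le> k' n x"
      "\<And>n x. k' n x \<le> max (\<kappa> n x) (h n x)" "\<And>n. (\<integral>\<^sup>+x. h n x \<partial>lam) \<le> ennreal (e n)"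
    by metis
  define H where "H x = (SUP n. h n x)" for x
  have H: "lsc H"
    unfolding H_def using kh(2) by (intro lsc_SUP)
  note [measurable] = lsc_borel_measurable[OF kh(1)] lsc_borel_measurable[OF kh(2)] lsc_borel_measurable[OF H]
  have "(\<integral>\<^sup>+x. H x \<partial>lam) \<le> (\<integral>\<^sup>+x. (\<Sum>n. h n x) \<partial>lam)"
  proof (intro nn_integral_mono)
    fix x
    have "h n x \<le> (\<Sum>n. h n x)" for n
      using sum_le_suminf[of "\<lambda>n. h n x" "{n}"] by (simp add: summableI)
    then show "H x \<le> (\<Sum>n. h n x)"
      unfolding H_def by (rule SUP_least)
  qed
  also have "\<dots> = (\<Sum>n. \<integral>\<^sup>+x. h n x \<partial>lam)"
    by (intro nn_integral_suminf) measurable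
  also have "\<dots> \<le> (\<Sum>n. ennreal (e n))"
    by (intro suminf_le kh(5) summableI)
  finally have intH: "(\<integral>\<^sup>+x. H x \<partial>lam) \<le> ennreal (\<delta>\<^sup>2)"
    by (simp add: e(2))
  have large: "\<exists>n\<in>UNIV. ennreal \<alpha> < (\<integral>\<^sup>+y. k' n (- y + x) \<partial>\<nu>)" if x: "x \<in> K" for x
  proof -
    obtain n where "ennreal \<alpha> < (\<integral>\<^sup>+y. \<kappa> n (- y + x) \<partial>\<nu>)"
      using K(2)[OF x] int_eq[OF x] by auto
    also have "\<dots> \<le> (\<integral>\<^sup>+y. k' n (- y + x) \<partial>\<nu>)"
      by (intro nn_integral_mono kh(3))
    finally show ?thesis by auto
  qed
  obtain f :: "'a \<Rightarrow> real" where f: "\<And>y. 0 \<le> f y" "integrable lam f" "ennreal (\<integral>y. f y \<partial>lam) \<le> emeasure \<nu> UNIV"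
      "\<And>x. x \<in> K \<Longrightarrow> \<exists>n\<in>UNIV. ennreal \<alpha> < (\<integral>\<^sup>+y. k' n (- y + x) * ennreal (f y) \<partial>lam)"
    by (rule convolution_step_function[OF lam \<nu> _ K(1), of UNIV k' "ennreal \<alpha>"]) (rule kh(1) large that; assumption)+
  have fm [measurable]: "f \<in> borel_measurable borel"
    using borel_measurable_integrable[OF f(2)] by (simp add: measurable_cong_sets[OF s refl])
  have intf: "(\<integral>\<^sup>+y. ennreal (f y) \<partial>lam) = ennreal (\<integral>y. f y \<partial>lam)"
    using f by (intro nn_integral_eq_integral) auto
  have f_le: "(\<integral>y. f y \<partial>lam) \<le> N"
    using f(3) N N0 by simp
  define \<phi> where "\<phi> = density lam (\<lambda>y. ennreal (f y))"
  have \<phi>: "inner_regular \<phi>" "emeasure \<phi> UNIV \<le> ennreal N"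
  proof -
    show "inner_regular \<phi>"
      unfolding \<phi>_def using intf by (intro inner_regular_density reg) auto
    show "emeasure \<phi> UNIV \<le> ennreal N"
      using f_le by (simp add: \<phi>_def emeasure_density s intf ennreal_leI)
  qed
  define E1 where "E1 = {x. \<exists>n\<in>UNIV. ennreal (\<alpha> - \<delta>) < (\<integral>\<^sup>+y. ennreal (k n (- y + x)) * ennreal (f y) \<partial>lam)}"
  define E2 where "E2 = {x. ennreal \<delta> < (\<integral>\<^sup>+y. H (- y + x) \<partial>\<phi>)}"
  have fin\<phi>: "emeasure \<phi> UNIV < \<infinity>"
    using \<phi>(2) by (rule le_less_trans) simp
  have E2m: "E2 \<in> sets lam"
    using lsc_convolution[OF \<phi>(1) fin\<phi> H] by (simp add: E2_def lsc_def s)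
  have "ennreal \<delta> * emeasure lam E2 \<le> emeasure \<phi> UNIV * (\<integral>\<^sup>+x. H x \<partial>lam)"
    unfolding E2_def by (rule lsc_convolution_weak_type[OF lam \<phi>(1) fin\<phi> H])
  also have "\<dots> \<le> ennreal N * ennreal (\<delta>\<^sup>2)"
    by (intro mult_mono \<phi>(2) intH) auto
  also have "\<dots> = ennreal (N * \<delta>\<^sup>2)"
    using N0 by (simp add: ennreal_mult)
  finally have "emeasure lam E2 \<le> ennreal (N * \<delta>\<^sup>2 / \<delta>)"
    using N0 \<delta> by (intro ennreal_mult_le_imp_le_divide) auto
  then have E2: "emeasure lam E2 \<le> ennreal (N * \<delta>)"
    using \<delta> by (simp add: power2_eq_square)
  \<comment> \<open>The set \<open>E1\<close> is only known through its outer measure, so it is enclosed in a Borel set \<open>B\<close>.\<close>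
  have E1_space: "E1 \<subseteq> space lam"
    by (simp add: inner_regular_space[OF reg])
  then obtain B where B: "B \<in> sets lam" "E1 \<subseteq> B" "outer_measure_of lam E1 = emeasure lam B"
    using outer_measure_of_attain[OF E1_space] by auto
  have "ennreal (\<alpha> - \<delta>) * outer_measure_of lam E1 \<le> ennreal (c * (\<integral>y. f y \<partial>lam))"
    unfolding E1_def using \<delta> by (intro weak_type_fun_nonneg[OF wt k(1) f(2,1)]) auto
  also have "\<dots> \<le> ennreal (c * N)"
    using f_le c by (intro ennreal_leI mult_left_mono) auto
  finally have E1: "emeasure lam B \<le> ennreal (c * N / (\<alpha> - \<delta>))"
    using \<delta> c N0 B(3) by (intro ennreal_mult_le_imp_le_divide) auto
  have "K \<subseteq> B \<union> E2"
  proof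
    fix x assume "x \<in> K"
    then obtain n where "ennreal \<alpha> < (\<integral>\<^sup>+y. k' n (- y + x) * ennreal (f y) \<partial>lam)"
      using f(4) by auto
    also have "\<dots> \<le> (\<integral>\<^sup>+y. ennreal (k n (- y + x)) * ennreal (f y) + H (- y + x) * ennreal (f y) \<partial>lam)"
    proof (intro nn_integral_mono)
      fix y
      have "h n (- y + x) \<le> H (- y + x)"
        unfolding H_def by (intro SUP_upper) auto
      then have "k' n (- y + x) \<le> ennreal (k n (- y + x)) + H (- y + x)"
        by (intro order_trans[OF kh(4)] max.boundedI)
          (auto intro: add_increasing add_increasing2 \<kappa>_le)
      then have "k' n (- y + x) * ennreal (f y) \<le> (ennreal (k n (- y + x)) + H (- y + x)) * ennreal (f y)"
        by (rule mult_right_mono) simp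
      then show "k' n (- y + x) * ennreal (f y) \<le> ennreal (k n (- y + x)) * ennreal (f y) + H (- y + x) * ennreal (f y)"
        by (simp add: distrib_right)
    qed
    also have "\<dots> = (\<integral>\<^sup>+y. ennreal (k n (- y + x)) * ennreal (f y) \<partial>lam) + (\<integral>\<^sup>+y. H (- y + x) * ennreal (f y) \<partial>lam)"
      by (intro nn_integral_add) measurable
    also have "(\<integral>\<^sup>+y. H (- y + x) * ennreal (f y) \<partial>lam) = (\<integral>\<^sup>+y. H (- y + x) \<partial>\<phi>)"
      unfolding \<phi>_def by (subst nn_integral_density) (auto simp: mult.commute)
    finally have sum: "ennreal \<alpha> < (\<integral>\<^sup>+y. ennreal (k n (- y + x)) * ennreal (f y) \<partial>lam) + (\<integral>\<^sup>+y. H (- y + x) \<partial>\<phi>)" .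
    show "x \<in> B \<union> E2"
    proof (rule ccontr)
      assume "x \<notin> B \<union> E2"
      then have "x \<notin> E1" "x \<notin> E2"
        using B(2) by auto
      then have "(\<integral>\<^sup>+y. ennreal (k n (- y + x)) * ennreal (f y) \<partial>lam) + (\<integral>\<^sup>+y. H (- y + x) \<partial>\<phi>) \<le>
          ennreal (\<alpha> - \<delta>) + ennreal \<delta>"
        by (intro add_mono) (simp_all add: E1_def E2_def not_less)
      also have "\<dots> = ennreal \<alpha>"
        using \<delta> by (simp flip: ennreal_plus)
      finally show False
        using sum by simp
    qed
  qed
  then have "emeasure lam K \<le> emeasure lam (B \<union> E2)"
    using B(1) E2m by (intro emeasure_mono) auto
  also have "\<dots> \<le> emeasure lam B + emeasure lam E2"
    using B(1) E2m by (rule emeasure_subadditive)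
  also have "\<dots> \<le> ennreal (c * N / (\<alpha> - \<delta>)) + ennreal (N * \<delta>)"
    by (intro add_mono E1 E2)
  also have "\<dots> = ennreal (c * N / (\<alpha> - \<delta>) + N * \<delta>)"
    using c N0 \<delta> by (intro ennreal_plus[symmetric]) auto
  finally show ?thesis
    by (simp add: N_def)
qed

text \<open>
  The level set is Borel, so its measure is again a supremum over compact subsets; there
  \<open>\<delta> \<rightarrow> 0\<close> in the estimate above.
\<close>

lemma weak_type_positive_borel:
  fixes lam :: "'a::{topological_group_add, t2_space} measure" and k :: "nat \<Rightarrow> 'a \<Rightarrow> real"
  assumes lc: "locally_compact_space (euclidean :: 'a topology)" and lam: "left_haar_measure lam" and c: "0 < c"
    and k: "\<And>n x. 0 \<le> k n x" "\<And>n. k n \<in> borel_measurable borel"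
    and wt: "weak_type_fun lam UNIV k c"
    and \<nu>: "inner_regular \<nu>" "emeasure \<nu> UNIV < \<infinity>" and \<alpha>: "0 < \<alpha>"
  shows "ennreal \<alpha> * outer_measure_of lam {x. \<exists>n\<in>UNIV. ennreal \<alpha> < (\<integral>\<^sup>+y. ennreal (k n (- y + x)) \<partial>\<nu>)}
        \<le> ennreal c * emeasure \<nu> UNIV"
proof -
  let ?E = "{x. \<exists>n\<in>UNIV. ennreal \<alpha> < (\<integral>\<^sup>+y. ennreal (k n (- y + x)) \<partial>\<nu>)}"
  note reg = left_haar_inner_regular[OF lam]
  note s = inner_regular_sets[OF reg]
  define N where "N = measure \<nu> UNIV"
  have N: "emeasure \<nu> UNIV = ennreal N"
    using \<nu>(2) by (simp add: N_def emeasure_eq_ennreal_measure less_top)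
  have [measurable]: "(\<lambda>x. \<integral>\<^sup>+y. ennreal (k n (- y + x)) \<partial>\<nu>) \<in> borel_measurable borel" for n
    using convolution_measurable[OF \<nu>, of "\<lambda>x. ennreal (k n x)"] k(2)[of n] by simp
  have E: "?E \<in> sets borel"
    by measurable
  have "ennreal \<alpha> * emeasure lam K \<le> ennreal c * emeasure \<nu> UNIV" if K: "compact K" "K \<subseteq> ?E" for K
  proof -
    have Kfin: "emeasure lam K = ennreal (measure lam K)"
      using lam K(1) by (simp add: left_haar_measure_def emeasure_eq_ennreal_measure less_top)
    have bound: "measure lam K \<le> c * N / (\<alpha> - \<delta>) + N * \<delta>" if "0 < \<delta>" "\<delta> < \<alpha>" for \<delta>
    proof -
      have "ennreal (measure lam K) \<le> ennreal (c * N / (\<alpha> - \<delta>) + N * \<delta>)"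
        unfolding N_def Kfin[symmetric] using that K
        by (intro weak_type_positive_borel_approx[OF lc lam c k wt \<nu>]) auto
      moreover have "0 \<le> c * N / (\<alpha> - \<delta>) + N * \<delta>"
        using c that by (simp add: N_def)
      ultimately show ?thesis
        by (simp only: ennreal_le_iff)
    qed
    have "((\<lambda>\<delta>. c * N / (\<alpha> - \<delta>) + N * \<delta>) \<longlongrightarrow> c * N / (\<alpha> - 0) + N * 0) (at_right 0)"
      using \<alpha> by (intro tendsto_intros) auto
    moreover have "eventually (\<lambda>\<delta>. measure lam K \<le> c * N / (\<alpha> - \<delta>) + N * \<delta>) (at_right 0)"
      using bound \<alpha> by (auto simp: eventually_at_right_field)
    ultimately have "measure lam K \<le> c * N / (\<alpha> - 0) + N * 0"
      by (rule tendsto_lowerbound) simp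
    then have "\<alpha> * measure lam K \<le> c * N"
      using \<alpha> by (simp add: field_simps)
    then show ?thesis
      using \<alpha> c by (simp add: Kfin N N_def flip: ennreal_mult)
  qed
  moreover have "outer_measure_of lam ?E = (SUP K\<in>{K. compact K \<and> K \<subseteq> ?E}. emeasure lam K)"
    using E reg s by (simp add: inner_regular_def)
  ultimately show ?thesis
    by (auto simp: SUP_mult_left_ennreal intro!: SUP_least)
qed

theorem theorem2:
  fixes lam :: "'a::{topological_group_add, t2_space} measure"
    and c :: real
  assumes "locally_compact_space (euclidean :: 'a topology)"
    and "left_haar_measure lam"
    and "c > 0"
  shows "(\<forall>(I :: 'i set) (k :: 'i \<Rightarrow> 'a \<Rightarrow> real).
            (\<forall>\<beta>\<in>I. (\<forall>x. k \<beta> x \<ge> 0) \<and> lower_semicontinuous (k \<beta>)) \<longrightarrow>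
            (weak_type_fun lam I k c \<longleftrightarrow> weak_type_meas lam I k c))
       \<and> (\<forall>k :: nat \<Rightarrow> 'a \<Rightarrow> real.
            (\<forall>n. (\<forall>x. k n x \<ge> 0) \<and> k n \<in> borel_measurable borel) \<longrightarrow>
            (weak_type_fun lam UNIV k c \<longleftrightarrow> weak_type_meas lam UNIV k c))"
proof (intro conjI allI impI)
  note reg = left_haar_inner_regular[OF assms(2)]
  {
    fix I :: "'i set" and k :: "'i \<Rightarrow> 'a \<Rightarrow> real"
    assume "\<forall>\<beta>\<in>I. (\<forall>x. k \<beta> x \<ge> 0) \<and> lower_semicontinuous (k \<beta>)"
    then have nonneg: "\<And>\<beta> x. \<beta> \<in> I \<Longrightarrow> 0 \<le> k \<beta> x" and lower: "\<And>\<beta>. \<beta> \<in> I \<Longrightarrow> lower_semicontinuous (k \<beta>)"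
      by auto
    have meas: "k \<beta> \<in> borel_measurable borel" if "\<beta> \<in> I" for \<beta>
      using lower[OF that] by (intro borel_measurableI_greater) (simp add: lower_semicontinuous_def)
    show "weak_type_fun lam I k c \<longleftrightarrow> weak_type_meas lam I k c"
    proof
      assume wt: "weak_type_fun lam I k c"
      show "weak_type_meas lam I k c"
        by (rule weak_type_meas_if_positive[OF nonneg meas assms(3) weak_type_positive_lsc[OF assms(2,3) nonneg lower wt]])
    next
      assume wt: "weak_type_meas lam I k c"
      show "weak_type_fun lam I k c"
        by (rule weak_type_fun_if_meas[OF reg assms(3) nonneg meas wt])
    qed
  next
    fix k :: "nat \<Rightarrow> 'a \<Rightarrow> real"
    assume "\<forall>n. (\<forall>x. k n x \<ge> 0) \<and> k n \<in> borel_measurable borel"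
    then have k: "\<And>n x. 0 \<le> k n x" "\<And>n. k n \<in> borel_measurable borel"
      by auto
    show "weak_type_fun lam UNIV k c \<longleftrightarrow> weak_type_meas lam UNIV k c"
    proof
      assume wt: "weak_type_fun lam UNIV k c"
      show "weak_type_meas lam UNIV k c"
        by (rule weak_type_meas_if_positive[OF k assms(3) weak_type_positive_borel[OF assms k wt]])
    next
      assume wt: "weak_type_meas lam UNIV k c"
      show "weak_type_fun lam UNIV k c"
        by (rule weak_type_fun_if_meas[OF reg assms(3) k wt])
    qed
  }
qed

end
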